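(* Let $\Gamma$ be a finite abelian group, let $\mathcal C$ be a $\Bbbk$-linear abelian monoidal category with simple monoidal unit, and let $A=\bigoplus_{i\in\Gamma}A_i$ be a $\Gamma$-graded twisted group algebra in $\mathcal C$. Let $x\in\mathcal C$ be a simple object and let $\Sigma_x:=\{i\in\Gamma\mid x\otimes A_i\cong x\}$ be its stabilizer. Then there is a two-cocycle $\varpi$ on $\Sigma_x$ with values in $\Bbbk^\times$ and an isomorphism $$\mathrm{End}_A(\mathrm{Ind}(x))\;\cong\;\Bbbk_\varpi\Sigma_x$$ of $\Sigma_x$-graded $\Bbbk$-algebras between the algebra of module endomorphisms of the induced right $A$-module $\mathrm{Ind}(x)=(x\otimes A,\mathrm{id}_x\otimes\mu)$ and the group algebra $\Bbbk\Sigma_x$ twisted by $\varpi$.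
   Context: $\Bbbk$ is an algebraically closed field whose characteristic is coprime to $|\Gamma|$ ($\Gamma$ is written additively). All categories are additive and $\Bbbk$-linear; associators and unitors are suppressed; $\mathrm{Hom}(\mathbf 1,\mathbf 1)\cong\Bbbk$. Schur's Lemma is used in $\mathcal C$ in the following form: for simple objects $x,y\in\mathcal C$ one has $\mathrm{Hom}(x,y)\cong\Bbbk$ if $x\cong y$, and $\mathrm{Hom}(x,y)=0$ otherwise. Algebra: an object $A$ with associative multiplication $\mu:A\otimes A\to A$ and unit $\eta:\mathbf 1\to A$. A $\Gamma$-graded algebra is one with a decomposition $A=\bigoplus_{i\in\Gamma}A_i$ such that $\mu$ maps $A_i\otimes A_j$ to $A_{i+j}$; the component is written $\mu_{i,j}:A_i\otimes A_j\to A_{i+j}$. Twisted group algebra: let $\mathrm{Pic}(\mathcal C)$ be the group of isomorphism classes of invertible objects of $\mathcal C$ and $\Gamma\le\mathrm{Pic}(\mathcal C)$ a finite (here abelian) subgroup. Let $L_i$ ($i\in\Gamma$) be invertible objects with $L_0\cong\mathbf 1$, $L_{i+j}\cong L_i\otimes L_j$, and $L_i\not\cong L_j$ for $i\ne j$. Choose bases $\lambda_{i,j}$ of the one-dimensional spaces $\mathrm{Hom}(L_i\otimes L_j,L_{i+j})$ and let $\psi(i,j,k)\in\Bbbk^\times$ be the three-cocycle describing the associator, i.e. $\lambda_{i+j,k}\circ(\lambda_{i,j}\otimes\mathrm{id})=\psi(i,j,k)^{-1}\,\lambda_{i,j+k}\circ(\mathrm{id}\otimes\lambda_{j,k})$ (with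 the associator suppressed on the right hand side). Let $\omega:\Gamma\times\Gamma\to\Bbbk^\times$ satisfy $\omega(i,j)\,\omega(i+j,k)=\omega(j,k)\,\omega(i,j+k)\,\psi(i,j,k)$. The twisted group algebra is $A=\bigoplus_{i\in\Gamma}L_i$ (so $A_i=L_i$) with $\mu_{i,j}=\omega(i,j)\,\lambda_{i,j}$ and with unit given by the embedding of $L_0\cong\mathbf 1$. Grading: a module endomorphism $f$ of $\mathrm{Ind}(x)$ is homogeneous of grade $i$ iff it maps $x\otimes A_j$ into $x\otimes A_{i+j}$ for all $j\in\Gamma$. The stabilizer $\Sigma_x$ is a subgroup of $\Gamma$. The twisted group algebra $\Bbbk_\varpi\Sigma_x$ over $\Bbbk$ has basis $\{b_s\mid s\in\Sigma_x\}$, with $b_s$ of grade $s$, and product $b_s\,b_{s'}=\varpi(s,s')\,b_{s+s'}$. *)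

theory Defs
  imports "HOL-Algebra.QuotRing" "HOL-Algebra.Algebraic_Closure_Type"
begin

section \<open>Categories\<close>

record ('o, 'm) cat =
  Obj :: "'o set"
  Arr :: "'m set"
  Dom :: "'m \<Rightarrow> 'o"
  Cod :: "'m \<Rightarrow> 'o"
  Ident :: "'o \<Rightarrow> 'm"
  Comp :: "'m \<Rightarrow> 'm \<Rightarrow> 'm" (infixr "\<bullet>\<index>" 70)

definition Hom :: "('o, 'm, 'z) cat_scheme \<Rightarrow> 'o \<Rightarrow> 'o \<Rightarrow> 'm set" where
  "Hom C a b = {f \<in> Arr C. Dom C f = a \<and> Cod C f = b}"

text \<open>As usual, \<open>g \<bullet> f\<close> is \<open>g\<close> after \<open>f\<close>; it is only meaningful if the codomain of \<open>f\<close> is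
  the domain of \<open>g\<close>.\<close>

locale category =
  fixes C :: "('o, 'm, 'z) cat_scheme" (structure)
  assumes Dom_Obj: "f \<in> Arr C \<Longrightarrow> Dom C f \<in> Obj C"
    and Cod_Obj: "f \<in> Arr C \<Longrightarrow> Cod C f \<in> Obj C"
    and Ident_Hom: "a \<in> Obj C \<Longrightarrow> Ident C a \<in> Hom C a a"
    and Comp_Hom: "\<lbrakk>f \<in> Hom C a b; g \<in> Hom C b c\<rbrakk> \<Longrightarrow> g \<bullet> f \<in> Hom C a c"
    and Comp_Ident_right: "f \<in> Hom C a b \<Longrightarrow> f \<bullet> Ident C a = f"
    and Comp_Ident_left: "f \<in> Hom C a b \<Longrightarrow> Ident C b \<bullet> f = f"
    and Comp_assoc:
      "\<lbrakk>f \<in> Hom C a b; g \<in> Hom C b c; h \<in> Hom C c d\<rbrakk> \<Longrightarrow> (h \<bullet> g) \<bullet> f = h \<bullet> (g \<bullet> f)"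

definition iso_arr :: "('o, 'm, 'z) cat_scheme \<Rightarrow> 'o \<Rightarrow> 'o \<Rightarrow> 'm \<Rightarrow> bool" where
  "iso_arr C a b f \<longleftrightarrow> f \<in> Hom C a b \<and>
     (\<exists>g \<in> Hom C b a. g \<bullet>\<^bsub>C\<^esub> f = Ident C a \<and> f \<bullet>\<^bsub>C\<^esub> g = Ident C b)"

definition iso_obj :: "('o, 'm, 'z) cat_scheme \<Rightarrow> 'o \<Rightarrow> 'o \<Rightarrow> bool" where
  "iso_obj C a b \<longleftrightarrow> (\<exists>f. iso_arr C a b f)"

definition monic :: "('o, 'm, 'z) cat_scheme \<Rightarrow> 'm \<Rightarrow> bool" where
  "monic C f \<longleftrightarrow> f \<in> Arr C \<and>
     (\<forall>c. \<forall>g \<in> Hom C c (Dom C f). \<forall>h \<in> Hom C c (Dom C f).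
        f \<bullet>\<^bsub>C\<^esub> g = f \<bullet>\<^bsub>C\<^esub> h \<longrightarrow> g = h)"

definition epic :: "('o, 'm, 'z) cat_scheme \<Rightarrow> 'm \<Rightarrow> bool" where
  "epic C f \<longleftrightarrow> f \<in> Arr C \<and>
     (\<forall>c. \<forall>g \<in> Hom C (Cod C f) c. \<forall>h \<in> Hom C (Cod C f) c.
        g \<bullet>\<^bsub>C\<^esub> f = h \<bullet>\<^bsub>C\<^esub> f \<longrightarrow> g = h)"

section \<open>Linear and abelian categories\<close>

record ('o, 'm, 'k) lincat = "('o, 'm) cat" +
  Zero :: "'o \<Rightarrow> 'o \<Rightarrow> 'm"
  Add :: "'m \<Rightarrow> 'm \<Rightarrow> 'm"
  Scale :: "'k \<Rightarrow> 'm \<Rightarrow> 'm"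

text \<open>The ground field is the type \<open>'k\<close>; \<open>ring_of_type_algebra\<close> turns it into a ring record.
  The fields \<open>mult\<close> and \<open>one\<close> of \<open>hom_space C a b\<close> are meaningful only for \<open>a = b\<close>, where
  they make it the endomorphism algebra of \<open>a\<close>.\<close>

definition hom_space :: "('o, 'm, 'k, 'z) lincat_scheme \<Rightarrow> 'o \<Rightarrow> 'o \<Rightarrow> ('k, 'm) module" where
  "hom_space C a b = \<lparr>carrier = Hom C a b, monoid.mult = Comp C, one = Ident C a,
     ring.zero = Zero C a b, add = Add C, module.smult = Scale C\<rparr>"

locale linear_category = category C
  for C :: "('o, 'm, 'k::field, 'z) lincat_scheme" (structure) +
  assumes hom_space_module: "\<lbrakk>a \<in> Obj C; b \<in> Obj C\<rbrakk> \<Longrightarrow>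
      module (ring_of_type_algebra :: 'k ring) (hom_space C a b)"
    and Comp_Add_right: "\<lbrakk>f \<in> Hom C a b; f' \<in> Hom C a b; g \<in> Hom C b c\<rbrakk> \<Longrightarrow>
      g \<bullet> Add C f f' = Add C (g \<bullet> f) (g \<bullet> f')"
    and Comp_Add_left: "\<lbrakk>f \<in> Hom C a b; g \<in> Hom C b c; g' \<in> Hom C b c\<rbrakk> \<Longrightarrow>
      Add C g g' \<bullet> f = Add C (g \<bullet> f) (g' \<bullet> f)"
    and Comp_Scale_right: "\<lbrakk>f \<in> Hom C a b; g \<in> Hom C b c\<rbrakk> \<Longrightarrow>
      g \<bullet> Scale C r f = Scale C r (g \<bullet> f)"
    and Comp_Scale_left: "\<lbrakk>f \<in> Hom C a b; g \<in> Hom C b c\<rbrakk> \<Longrightarrow>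
      Scale C r g \<bullet> f = Scale C r (g \<bullet> f)"

definition zero_obj :: "('o, 'm, 'k, 'z) lincat_scheme \<Rightarrow> 'o \<Rightarrow> bool" where
  "zero_obj C z \<longleftrightarrow> z \<in> Obj C \<and> Ident C z = Zero C z z"

definition direct_sum ::
  "('o, 'm, 'k, 'z) lincat_scheme \<Rightarrow> 'i set \<Rightarrow> ('i \<Rightarrow> 'o) \<Rightarrow> 'o \<Rightarrow> ('i \<Rightarrow> 'm) \<Rightarrow> ('i \<Rightarrow> 'm) \<Rightarrow> bool"
  where
  "direct_sum C I B S inc prj \<longleftrightarrow> finite I \<and> S \<in> Obj C \<and>
     (\<forall>i\<in>I. B i \<in> Obj C \<and> inc i \<in> Hom C (B i) S \<and> prj i \<in> Hom C S (B i)) \<and>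
     (\<forall>i\<in>I. \<forall>j\<in>I. prj j \<bullet>\<^bsub>C\<^esub> inc i = (if i = j then Ident C (B i) else Zero C (B i) (B j))) \<and>
     finsum (hom_space C S S) (\<lambda>i. inc i \<bullet>\<^bsub>C\<^esub> prj i) I = Ident C S"

definition is_kernel :: "('o, 'm, 'k, 'z) lincat_scheme \<Rightarrow> 'm \<Rightarrow> 'm \<Rightarrow> bool" where
  "is_kernel C f k \<longleftrightarrow> f \<in> Arr C \<and> k \<in> Arr C \<and> Cod C k = Dom C f \<and>
     f \<bullet>\<^bsub>C\<^esub> k = Zero C (Dom C k) (Cod C f) \<and>
     (\<forall>c. \<forall>g \<in> Hom C c (Dom C f). f \<bullet>\<^bsub>C\<^esub> g = Zero C c (Cod C f) \<longrightarrow>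
        (\<exists>!h. h \<in> Hom C c (Dom C k) \<and> k \<bullet>\<^bsub>C\<^esub> h = g))"

definition is_cokernel :: "('o, 'm, 'k, 'z) lincat_scheme \<Rightarrow> 'm \<Rightarrow> 'm \<Rightarrow> bool" where
  "is_cokernel C f q \<longleftrightarrow> f \<in> Arr C \<and> q \<in> Arr C \<and> Dom C q = Cod C f \<and>
     q \<bullet>\<^bsub>C\<^esub> f = Zero C (Dom C f) (Cod C q) \<and>
     (\<forall>c. \<forall>g \<in> Hom C (Cod C f) c. g \<bullet>\<^bsub>C\<^esub> f = Zero C (Dom C f) c \<longrightarrow>
        (\<exists>!h. h \<in> Hom C (Cod C q) c \<and> h \<bullet>\<^bsub>C\<^esub> q = g))"

locale linear_abelian_category = linear_category C
  for C :: "('o, 'm, 'k::field, 'z) lincat_scheme" (structure) +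
  assumes ex_zero_obj: "\<exists>z. zero_obj C z"
    and ex_direct_sum: "\<lbrakk>a \<in> Obj C; b \<in> Obj C\<rbrakk> \<Longrightarrow>
      \<exists>S inc prj. direct_sum C (UNIV :: bool set) (\<lambda>i. if i then a else b) S inc prj"
    and ex_kernel: "f \<in> Arr C \<Longrightarrow> \<exists>k. is_kernel C f k"
    and ex_cokernel: "f \<in> Arr C \<Longrightarrow> \<exists>q. is_cokernel C f q"
    and monic_is_kernel: "monic C m \<Longrightarrow> \<exists>f. is_kernel C f m"
    and epic_is_cokernel: "epic C e \<Longrightarrow> \<exists>f. is_cokernel C f e"

definition simple_obj :: "('o, 'm, 'k, 'z) lincat_scheme \<Rightarrow> 'o \<Rightarrow> bool" where
  "simple_obj C x \<longleftrightarrow> x \<in> Obj C \<and> \<not> zero_obj C x \<and>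
     (\<forall>y m. m \<in> Hom C y x \<and> monic C m \<longrightarrow> zero_obj C y \<or> iso_arr C y x m)"

text \<open>\<open>f\<close> is a basis of a one-dimensional space \<open>Hom(a,b)\<close>.\<close>

definition hom_line_basis :: "('o, 'm, 'k, 'z) lincat_scheme \<Rightarrow> 'o \<Rightarrow> 'o \<Rightarrow> 'm \<Rightarrow> bool" where
  "hom_line_basis C a b f \<longleftrightarrow> f \<in> Hom C a b \<and> f \<noteq> Zero C a b \<and>
     (\<forall>g \<in> Hom C a b. \<exists>r. g = Scale C r f)"

definition hom_one_dim :: "('o, 'm, 'k, 'z) lincat_scheme \<Rightarrow> 'o \<Rightarrow> 'o \<Rightarrow> bool" where
  "hom_one_dim C a b \<longleftrightarrow> (\<exists>f. hom_line_basis C a b f)"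

definition schur_lemma :: "('o, 'm, 'k, 'z) lincat_scheme \<Rightarrow> bool" where
  "schur_lemma C \<longleftrightarrow> (\<forall>x y. simple_obj C x \<and> simple_obj C y \<longrightarrow>
     (if iso_obj C x y then hom_one_dim C x y else Hom C x y = {Zero C x y}))"

section \<open>Monoidal categories\<close>

text \<open>Associators and unitors are kept explicit, with
  \<open>Assoc a b c : (a \<otimes> b) \<otimes> c \<rightarrow> a \<otimes> (b \<otimes> c)\<close>,
  \<open>LUnitor a : 1 \<otimes> a \<rightarrow> a\<close> and \<open>RUnitor a : a \<otimes> 1 \<rightarrow> a\<close>.
  \<open>\<otimes>\<^sub>O\<close> is the tensor product of objects, \<open>\<otimes>\<^sub>M\<close> that of morphisms.\<close>

record ('o, 'm, 'k) moncat = "('o, 'm, 'k) lincat" +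
  Unit :: "'o"
  TensorO :: "'o \<Rightarrow> 'o \<Rightarrow> 'o" (infixl "\<otimes>\<^sub>O\<index>" 75)
  TensorM :: "'m \<Rightarrow> 'm \<Rightarrow> 'm" (infixl "\<otimes>\<^sub>M\<index>" 75)
  Assoc :: "'o \<Rightarrow> 'o \<Rightarrow> 'o \<Rightarrow> 'm"
  LUnitor :: "'o \<Rightarrow> 'm"
  RUnitor :: "'o \<Rightarrow> 'm"

locale linear_abelian_monoidal_category = linear_abelian_category C
  for C :: "('o, 'm, 'k::field, 'z) moncat_scheme" (structure) +
  assumes Unit_Obj: "Unit C \<in> Obj C"
    and TensorO_Obj: "\<lbrakk>a \<in> Obj C; b \<in> Obj C\<rbrakk> \<Longrightarrow> a \<otimes>\<^sub>O b \<in> Obj C"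
    and TensorM_Hom: "\<lbrakk>f \<in> Hom C a b; g \<in> Hom C c d\<rbrakk> \<Longrightarrow>
      f \<otimes>\<^sub>M g \<in> Hom C (a \<otimes>\<^sub>O c) (b \<otimes>\<^sub>O d)"
    and TensorM_Ident: "\<lbrakk>a \<in> Obj C; b \<in> Obj C\<rbrakk> \<Longrightarrow>
      Ident C a \<otimes>\<^sub>M Ident C b = Ident C (a \<otimes>\<^sub>O b)"
    and TensorM_Comp:
      "\<lbrakk>f \<in> Hom C a b; f' \<in> Hom C b c; g \<in> Hom C a' b'; g' \<in> Hom C b' c'\<rbrakk> \<Longrightarrow>
      (f' \<bullet> f) \<otimes>\<^sub>M (g' \<bullet> g) = (f' \<otimes>\<^sub>M g') \<bullet> (f \<otimes>\<^sub>M g)"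
    and TensorM_Add_left: "\<lbrakk>f \<in> Hom C a b; f' \<in> Hom C a b; g \<in> Hom C c d\<rbrakk> \<Longrightarrow>
      Add C f f' \<otimes>\<^sub>M g = Add C (f \<otimes>\<^sub>M g) (f' \<otimes>\<^sub>M g)"
    and TensorM_Add_right: "\<lbrakk>f \<in> Hom C a b; g \<in> Hom C c d; g' \<in> Hom C c d\<rbrakk> \<Longrightarrow>
      f \<otimes>\<^sub>M Add C g g' = Add C (f \<otimes>\<^sub>M g) (f \<otimes>\<^sub>M g')"
    and TensorM_Scale_left: "\<lbrakk>f \<in> Hom C a b; g \<in> Hom C c d\<rbrakk> \<Longrightarrow>
      Scale C r f \<otimes>\<^sub>M g = Scale C r (f \<otimes>\<^sub>M g)"
    and TensorM_Scale_right: "\<lbrakk>f \<in> Hom C a b; g \<in> Hom C c d\<rbrakk> \<Longrightarrow>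
      f \<otimes>\<^sub>M Scale C r g = Scale C r (f \<otimes>\<^sub>M g)"
    and Assoc_iso: "\<lbrakk>a \<in> Obj C; b \<in> Obj C; c \<in> Obj C\<rbrakk> \<Longrightarrow>
      iso_arr C (a \<otimes>\<^sub>O b \<otimes>\<^sub>O c) (a \<otimes>\<^sub>O (b \<otimes>\<^sub>O c)) (Assoc C a b c)"
    and LUnitor_iso: "a \<in> Obj C \<Longrightarrow> iso_arr C (Unit C \<otimes>\<^sub>O a) a (LUnitor C a)"
    and RUnitor_iso: "a \<in> Obj C \<Longrightarrow> iso_arr C (a \<otimes>\<^sub>O Unit C) a (RUnitor C a)"
    and Assoc_natural:
      "\<lbrakk>f \<in> Hom C a a'; g \<in> Hom C b b'; h \<in> Hom C c c'\<rbrakk> \<Longrightarrow>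
      Assoc C a' b' c' \<bullet> (f \<otimes>\<^sub>M g \<otimes>\<^sub>M h) = (f \<otimes>\<^sub>M (g \<otimes>\<^sub>M h)) \<bullet> Assoc C a b c"
    and LUnitor_natural: "f \<in> Hom C a b \<Longrightarrow>
      LUnitor C b \<bullet> (Ident C (Unit C) \<otimes>\<^sub>M f) = f \<bullet> LUnitor C a"
    and RUnitor_natural: "f \<in> Hom C a b \<Longrightarrow>
      RUnitor C b \<bullet> (f \<otimes>\<^sub>M Ident C (Unit C)) = f \<bullet> RUnitor C a"
    and pentagon: "\<lbrakk>a \<in> Obj C; b \<in> Obj C; c \<in> Obj C; d \<in> Obj C\<rbrakk> \<Longrightarrow>
      Assoc C a b (c \<otimes>\<^sub>O d) \<bullet> Assoc C (a \<otimes>\<^sub>O b) c d =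
      (Ident C a \<otimes>\<^sub>M Assoc C b c d) \<bullet> Assoc C a (b \<otimes>\<^sub>O c) d \<bullet> (Assoc C a b c \<otimes>\<^sub>M Ident C d)"
    and triangle: "\<lbrakk>a \<in> Obj C; b \<in> Obj C\<rbrakk> \<Longrightarrow>
      (Ident C a \<otimes>\<^sub>M LUnitor C b) \<bullet> Assoc C a (Unit C) b = RUnitor C a \<otimes>\<^sub>M Ident C b"

definition invertible_obj :: "('o, 'm, 'k, 'z) moncat_scheme \<Rightarrow> 'o \<Rightarrow> bool" where
  "invertible_obj C a \<longleftrightarrow> a \<in> Obj C \<and>
     (\<exists>b \<in> Obj C. iso_obj C (a \<otimes>\<^sub>O\<^bsub>C\<^esub> b) (Unit C) \<and> iso_obj C (b \<otimes>\<^sub>O\<^bsub>C\<^esub> a) (Unit C))"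

section \<open>Algebras and induced modules\<close>

definition algebra_obj :: "('o, 'm, 'k, 'z) moncat_scheme \<Rightarrow> 'o \<Rightarrow> 'm \<Rightarrow> 'm \<Rightarrow> bool" where
  "algebra_obj C A \<mu> \<eta> \<longleftrightarrow> A \<in> Obj C \<and>
     \<mu> \<in> Hom C (A \<otimes>\<^sub>O\<^bsub>C\<^esub> A) A \<and> \<eta> \<in> Hom C (Unit C) A \<and>
     \<mu> \<bullet>\<^bsub>C\<^esub> (\<mu> \<otimes>\<^sub>M\<^bsub>C\<^esub> Ident C A) = \<mu> \<bullet>\<^bsub>C\<^esub> (Ident C A \<otimes>\<^sub>M\<^bsub>C\<^esub> \<mu>) \<bullet>\<^bsub>C\<^esub> Assoc C A A A \<and>
     \<mu> \<bullet>\<^bsub>C\<^esub> (\<eta> \<otimes>\<^sub>M\<^bsub>C\<^esub> Ident C A) = LUnitor C A \<and>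
     \<mu> \<bullet>\<^bsub>C\<^esub> (Ident C A \<otimes>\<^sub>M\<^bsub>C\<^esub> \<eta>) = RUnitor C A"

text \<open>A right module is an object \<open>M\<close> with an action \<open>\<rho> : M \<otimes> A \<rightarrow> M\<close>.\<close>

definition End_alg ::
  "('o, 'm, 'k, 'z) moncat_scheme \<Rightarrow> 'o \<Rightarrow> 'o \<Rightarrow> 'm \<Rightarrow> ('k, 'm) module" where
  "End_alg C A M \<rho> = (hom_space C M M)
     \<lparr>carrier := {f \<in> Hom C M M. f \<bullet>\<^bsub>C\<^esub> \<rho> = \<rho> \<bullet>\<^bsub>C\<^esub> (f \<otimes>\<^sub>M\<^bsub>C\<^esub> Ident C A)}\<rparr>"

definition Ind_action :: "('o, 'm, 'k, 'z) moncat_scheme \<Rightarrow> 'o \<Rightarrow> 'm \<Rightarrow> 'o \<Rightarrow> 'm" where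
  "Ind_action C A \<mu> x = (Ident C x \<otimes>\<^sub>M\<^bsub>C\<^esub> \<mu>) \<bullet>\<^bsub>C\<^esub> Assoc C x A A"

definition End_Ind ::
  "('o, 'm, 'k, 'z) moncat_scheme \<Rightarrow> 'o \<Rightarrow> 'm \<Rightarrow> 'o \<Rightarrow> ('k, 'm) module" where
  "End_Ind C A \<mu> x = End_alg C A (x \<otimes>\<^sub>O\<^bsub>C\<^esub> A) (Ind_action C A \<mu> x)"

text \<open>Here \<open>B j\<close> with the inclusion \<open>inc j\<close> is the component \<open>A\<^sub>j\<close> of the graded algebra \<open>A\<close>.\<close>

definition End_Ind_grade ::
  "('o, 'm, 'k, 'z) moncat_scheme \<Rightarrow> ('g::ab_group_add \<Rightarrow> 'o) \<Rightarrow> 'o \<Rightarrow> ('g \<Rightarrow> 'm) \<Rightarrow> 'm \<Rightarrow> 'o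
     \<Rightarrow> 'g \<Rightarrow> 'm set" where
  "End_Ind_grade C B A inc \<mu> x i = {f \<in> carrier (End_Ind C A \<mu> x).
     \<forall>j. \<exists>g \<in> Hom C (x \<otimes>\<^sub>O\<^bsub>C\<^esub> B j) (x \<otimes>\<^sub>O\<^bsub>C\<^esub> B (i + j)).
       f \<bullet>\<^bsub>C\<^esub> (Ident C x \<otimes>\<^sub>M\<^bsub>C\<^esub> inc j) = (Ident C x \<otimes>\<^sub>M\<^bsub>C\<^esub> inc (i + j)) \<bullet>\<^bsub>C\<^esub> g}"

definition stabilizer :: "('o, 'm, 'k, 'z) moncat_scheme \<Rightarrow> ('g \<Rightarrow> 'o) \<Rightarrow> 'o \<Rightarrow> 'g set" where
  "stabilizer C B x = {i. iso_obj C (x \<otimes>\<^sub>O\<^bsub>C\<^esub> B i) x}"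

text \<open>The finite abelian group is the type \<open>'g\<close>, embedded into the Picard group by \<open>i \<mapsto> L i\<close>.
  Associativity in \<open>algebra\<close> already follows from \<open>omega_eq\<close>; the unit laws determine which
  scalar multiple of an isomorphism \<open>1 \<rightarrow> L 0\<close> is the unit, since neither \<open>\<omega>\<close> nor \<open>\<lambda>\<close> is
  assumed to be normalised.\<close>

locale twisted_group_algebra = linear_abelian_monoidal_category C
  for C :: "('o, 'm, 'k::field, 'z) moncat_scheme" (structure) +
  fixes L :: "'g::{finite, ab_group_add} \<Rightarrow> 'o"
    and lam :: "'g \<Rightarrow> 'g \<Rightarrow> 'm"
    and \<psi> :: "'g \<Rightarrow> 'g \<Rightarrow> 'g \<Rightarrow> 'k"
    and \<omega> :: "'g \<Rightarrow> 'g \<Rightarrow> 'k"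
    and A :: "'o" and inc prj :: "'g \<Rightarrow> 'm" and \<mu> \<eta> :: "'m"
  assumes L_invertible: "invertible_obj C (L i)"
    and L_zero: "iso_obj C (L 0) (Unit C)"
    and L_add: "iso_obj C (L (i + j)) (L i \<otimes>\<^sub>O L j)"
    and L_distinct: "i \<noteq> j \<Longrightarrow> \<not> iso_obj C (L i) (L j)"
    and lam_basis: "hom_line_basis C (L i \<otimes>\<^sub>O L j) (L (i + j)) (lam i j)"
    and psi_nonzero: "\<psi> i j k \<noteq> 0"
    and psi_eq: "lam (i + j) k \<bullet> (lam i j \<otimes>\<^sub>M Ident C (L k)) =
      Scale C (inverse (\<psi> i j k))
        (lam i (j + k) \<bullet> (Ident C (L i) \<otimes>\<^sub>M lam j k) \<bullet> Assoc C (L i) (L j) (L k))"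
    and omega_nonzero: "\<omega> i j \<noteq> 0"
    and omega_eq: "\<omega> i j * \<omega> (i + j) k = \<omega> j k * \<omega> i (j + k) * \<psi> i j k"
    and sum_L: "direct_sum C UNIV L A inc prj"
    and mu_component: "\<mu> \<bullet> (inc i \<otimes>\<^sub>M inc j) = inc (i + j) \<bullet> Scale C (\<omega> i j) (lam i j)"
    and eta_component: "\<exists>u. iso_arr C (Unit C) (L 0) u \<and> \<eta> = inc 0 \<bullet> u"
    and algebra: "algebra_obj C A \<mu> \<eta>"

section \<open>Graded algebras over the ground field\<close>

text \<open>\<open>algebra\<close> in \<open>HOL-Algebra\<close> is commutative, so it cannot be used here.\<close>

definition k_algebra :: "('k::field, 'a, 'z) module_scheme \<Rightarrow> bool" where
  "k_algebra R \<longleftrightarrow> ring R \<and> module (ring_of_type_algebra :: 'k ring) R \<and>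
     (\<forall>r. \<forall>a \<in> carrier R. \<forall>b \<in> carrier R.
        (r \<odot>\<^bsub>R\<^esub> a) \<otimes>\<^bsub>R\<^esub> b = r \<odot>\<^bsub>R\<^esub> (a \<otimes>\<^bsub>R\<^esub> b) \<and>
        a \<otimes>\<^bsub>R\<^esub> (r \<odot>\<^bsub>R\<^esub> b) = r \<odot>\<^bsub>R\<^esub> (a \<otimes>\<^bsub>R\<^esub> b))"

definition add_subgroup :: "'g::ab_group_add set \<Rightarrow> bool" where
  "add_subgroup S \<longleftrightarrow> 0 \<in> S \<and> (\<forall>s\<in>S. \<forall>t\<in>S. s + t \<in> S) \<and> (\<forall>s\<in>S. - s \<in> S)"

definition graded_k_algebra ::
  "'g::ab_group_add set \<Rightarrow> ('k::field, 'a, 'z) module_scheme \<Rightarrow> ('g \<Rightarrow> 'a set) \<Rightarrow> bool" where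
  "graded_k_algebra S R gr \<longleftrightarrow> finite S \<and> add_subgroup S \<and> k_algebra R \<and>
     (\<forall>s\<in>S. submodule (gr s) (ring_of_type_algebra :: 'k ring) R) \<and>
     (\<forall>a \<in> carrier R. \<exists>!c. c \<in> (\<Pi>\<^sub>E s\<in>S. gr s) \<and> a = finsum R c S) \<and>
     (\<forall>s\<in>S. \<forall>t\<in>S. \<forall>a \<in> gr s. \<forall>b \<in> gr t. a \<otimes>\<^bsub>R\<^esub> b \<in> gr (s + t))"

definition graded_k_algebra_iso ::
  "'g::ab_group_add set \<Rightarrow> ('k::field, 'a, 'y) module_scheme \<Rightarrow> ('g \<Rightarrow> 'a set)
     \<Rightarrow> ('k, 'b, 'z) module_scheme \<Rightarrow> ('g \<Rightarrow> 'b set) \<Rightarrow> ('a \<Rightarrow> 'b) \<Rightarrow> bool" where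
  "graded_k_algebra_iso S R gr R' gr' \<Phi> \<longleftrightarrow>
     graded_k_algebra S R gr \<and> graded_k_algebra S R' gr' \<and> \<Phi> \<in> ring_iso R R' \<and>
     (\<forall>r. \<forall>a \<in> carrier R. \<Phi> (r \<odot>\<^bsub>R\<^esub> a) = r \<odot>\<^bsub>R'\<^esub> \<Phi> a) \<and>
     (\<forall>s\<in>S. \<Phi> ` gr s = gr' s)"

section \<open>Twisted group algebras over the ground field\<close>

definition two_cocycle :: "'g::ab_group_add set \<Rightarrow> ('g \<Rightarrow> 'g \<Rightarrow> 'k::field) \<Rightarrow> bool" where
  "two_cocycle S \<theta> \<longleftrightarrow> (\<forall>s\<in>S. \<forall>t\<in>S. \<theta> s t \<noteq> 0) \<and>
     (\<forall>s\<in>S. \<forall>t\<in>S. \<forall>u\<in>S. \<theta> s t * \<theta> (s + t) u = \<theta> t u * \<theta> s (t + u))"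

text \<open>An element \<open>\<Sum>s\<in>S. a s \<cdot> b\<^sub>s\<close> is represented by its coefficient function \<open>a\<close>, which vanishes
  outside \<open>S\<close>. As \<open>\<theta>\<close> need not be normalised, the unit is \<open>\<theta>(0,0)\<^sup>-\<^sup>1 b\<^sub>0\<close>.\<close>

definition twisted_basis :: "'g \<Rightarrow> 'g \<Rightarrow> 'k::field" where
  "twisted_basis s = (\<lambda>g. if g = s then 1 else 0)"

definition twisted_group_ring ::
  "'g::ab_group_add set \<Rightarrow> ('g \<Rightarrow> 'g \<Rightarrow> 'k::field) \<Rightarrow> ('k, 'g \<Rightarrow> 'k) module" where
  "twisted_group_ring S \<theta> =
     \<lparr>carrier = {a. \<forall>g. g \<notin> S \<longrightarrow> a g = 0},
      monoid.mult = (\<lambda>a b g. \<Sum>(s, t) \<in> {(s, t). s \<in> S \<and> t \<in> S \<and> s + t = g}. a s * b t * \<theta> s t),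
      one = (\<lambda>g. inverse (\<theta> 0 0) * twisted_basis 0 g),
      ring.zero = (\<lambda>g. 0),
      add = (\<lambda>a b g. a g + b g),
      module.smult = (\<lambda>r a g. r * a g)\<rparr>"

definition twisted_grade :: "'g \<Rightarrow> ('g \<Rightarrow> 'k::field) set" where
  "twisted_grade s = {\<lambda>g. r * twisted_basis s g | r. True}"

lemma twisted_basis_mult:
  assumes "finite S" "s \<in> S" "t \<in> S"
  shows "twisted_basis s \<otimes>\<^bsub>twisted_group_ring S \<theta>\<^esub> twisted_basis t =
    \<theta> s t \<odot>\<^bsub>twisted_group_ring S \<theta>\<^esub> twisted_basis (s + t)"
proof
  fix g
  let ?P = "{(p, q). p \<in> S \<and> q \<in> S \<and> p + q = g}"
  let ?f = "\<lambda>(p, q). (if p = s then 1 else 0) * (if q = t then 1 else 0) * \<theta> p q"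
  have "sum ?f ?P = (if s + t = g then \<theta> s t else 0)"
  proof (cases "s + t = g")
    case True
    have "sum ?f ?P = sum ?f {(s, t)}"
    proof (rule sum.mono_neutral_right)
      show "finite ?P"
        by (rule finite_subset[of _ "S \<times> S"]) (use assms in auto)
    qed (use assms True in \<open>auto split: if_splits\<close>)
    then show ?thesis using True by simp
  next
    case False
    then show ?thesis by (auto intro!: sum.neutral)
  qed
  then show "(twisted_basis s \<otimes>\<^bsub>twisted_group_ring S \<theta>\<^esub> twisted_basis t) g =
    (\<theta> s t \<odot>\<^bsub>twisted_group_ring S \<theta>\<^esub> twisted_basis (s + t)) g"
    by (auto simp: twisted_group_ring_def twisted_basis_def)
qed

end

theory Submission
  imports Defs
begin

text \<open>
  A module endomorphism \<open>f\<close> of \<open>x \<otimes> A\<close> is determined by its restriction \<open>x \<rightarrow> x \<otimes> A\<close> along the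
  unit of \<open>A\<close>. As \<open>L i\<close> is invertible, \<open>x \<otimes> L i\<close> is simple, so by Schur's lemma this restriction
  is a combination of the composites \<open>x \<cong> x \<otimes> L s \<rightarrow> x \<otimes> A\<close> with \<open>s\<close> in the stabilizer. Extending
  such a composite to \<open>x \<otimes> A\<close> gives an endomorphism \<open>b s\<close> of grade \<open>s\<close> all of whose components
  \<open>x \<otimes> L j \<rightarrow> x \<otimes> L (s + j)\<close> are isomorphisms. Hence the \<open>b s\<close> form a basis, \<open>b s \<bullet> b t\<close> is a
  nonzero multiple of \<open>b (s + t)\<close>, and associativity of composition makes these scalars a cocycle.
\<close>

section \<open>Algebras with a homogeneous basis\<close>

text \<open>The two halves of the basis property have different sources. Spanning needs only that
  extending the restriction of \<open>f\<close> returns \<open>f\<close>; independence is read off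
  on the single summand \<open>x \<otimes> L 0\<close>. No formula for the cocycle in terms of
  \<open>\<omega>\<close>, \<open>\<psi>\<close> and the chosen isomorphisms is computed: its values
  exist because the homogeneous parts are lines closed under multiplication of grades. The remaining
  linear algebra is isolated in a locale for algebras with a homogeneous basis. It serves twice, for
  the endomorphism algebra and for the twisted group ring, whose ring axioms are in turn transported
  from the endomorphism algebra.\<close>

lemma ring_of_type_algebra_sel [simp]:
  "carrier (ring_of_type_algebra :: 'k::comm_ring_1 ring) = UNIV"
  "x \<otimes>\<^bsub>ring_of_type_algebra\<^esub> y = x * y"
  "x \<oplus>\<^bsub>ring_of_type_algebra\<^esub> y = x + y"
  "\<one>\<^bsub>ring_of_type_algebra\<^esub> = (1 :: 'k)"
  "\<zero>\<^bsub>ring_of_type_algebra\<^esub> = (0 :: 'k)"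
  by (simp_all add: ring_of_type_algebra_def)

text \<open>In a monoid additivity does not force \<open>h\<close> to preserve zero, hence the
  separate hypothesis. Composition, tensoring and \<open>extend\<close> are pulled through finite
  sums as instances.\<close>

lemma finsum_additive:
  assumes "abelian_monoid R" "abelian_monoid R'"
    and h: "h \<in> carrier R \<rightarrow> carrier R'" "h \<zero>\<^bsub>R\<^esub> = \<zero>\<^bsub>R'\<^esub>"
      "\<And>a b. a \<in> carrier R \<Longrightarrow> b \<in> carrier R \<Longrightarrow> h (a \<oplus>\<^bsub>R\<^esub> b) = h a \<oplus>\<^bsub>R'\<^esub> h b"
    and "finite I" "f \<in> I \<rightarrow> carrier R"
  shows "h (finsum R f I) = finsum R' (\<lambda>i. h (f i)) I"
proof -
  interpret R: abelian_monoid R by fact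
  interpret R': abelian_monoid R' by fact
  show ?thesis
    using assms(6,7)
  proof (induction I)
    case (insert i I)
    then have "f i \<in> carrier R" "f \<in> I \<rightarrow> carrier R" "(\<lambda>i. h (f i)) \<in> I \<rightarrow> carrier R'"
      "h (f i) \<in> carrier R'"
      using h(1) by auto
    then show ?case using insert by (simp add: h(3))
  qed (simp add: h(2))
qed

text \<open>Values in a group allow cancellation, so \<open>h\<close> of zero vanishes by itself.
  This form serves for scalar-valued functionals such as coordinates and evaluation at a
  point.\<close>

lemma sum_additive:
  fixes h :: "'a \<Rightarrow> 'k::ab_group_add"
  assumes "abelian_monoid R"
    and h: "\<And>a b. a \<in> carrier R \<Longrightarrow> b \<in> carrier R \<Longrightarrow> h (a \<oplus>\<^bsub>R\<^esub> b) = h a + h b"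
    and "finite I" "f \<in> I \<rightarrow> carrier R"
  shows "h (finsum R f I) = (\<Sum>i\<in>I. h (f i))"
proof -
  interpret R: abelian_monoid R by fact
  have h0: "h \<zero>\<^bsub>R\<^esub> = 0"
    using h[of "\<zero>\<^bsub>R\<^esub>" "\<zero>\<^bsub>R\<^esub>"] by simp
  show ?thesis
    using assms(3,4)
  proof (induction I rule: finite_induct)
    case (insert i I)
    then have "f i \<in> carrier R" "f \<in> I \<rightarrow> carrier R"
      by auto
    then show ?case using insert by (simp add: h)
  qed (simp add: h0)
qed

text \<open>Linear independence is encoded by a dual family of functionals: \<open>coord_b\<close>
  makes the coefficients in \<open>span\<close> unique, so only their existence has to be
  supplied.\<close>

locale coordinate_basis =
  fixes R :: "('k::field, 'a, 'z) module_scheme" (structure)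
    and S :: "'g::ab_group_add set"
    and b :: "'g \<Rightarrow> 'a"
    and coord :: "'g \<Rightarrow> 'a \<Rightarrow> 'k"
  assumes k_algebra: "k_algebra R"
    and fin: "finite S"
    and b_closed: "s \<in> S \<Longrightarrow> b s \<in> carrier R"
    and coord_add: "\<lbrakk>s \<in> S; a \<in> carrier R; a' \<in> carrier R\<rbrakk> \<Longrightarrow>
      coord s (a \<oplus> a') = coord s a + coord s a'"
    and coord_smult: "\<lbrakk>s \<in> S; a \<in> carrier R\<rbrakk> \<Longrightarrow> coord s (r \<odot> a) = r * coord s a"
    and coord_b: "\<lbrakk>s \<in> S; t \<in> S\<rbrakk> \<Longrightarrow> coord s (b t) = (if s = t then 1 else 0)"
    and span: "a \<in> carrier R \<Longrightarrow> \<exists>c. a = finsum R (\<lambda>s. c s \<odot> b s) S"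
begin

sublocale Alg: ring R
  using k_algebra by (simp add: k_algebra_def)

sublocale Mod: module "ring_of_type_algebra :: 'k ring" R
  using k_algebra by (simp add: k_algebra_def)

lemma smult_simps:
  "a \<in> carrier R \<Longrightarrow> r \<odot> a \<in> carrier R"
  "a \<in> carrier R \<Longrightarrow> r \<odot> (r' \<odot> a) = (r * r') \<odot> a"
  "a \<in> carrier R \<Longrightarrow> a' \<in> carrier R \<Longrightarrow> (r \<odot> a) \<otimes> a' = r \<odot> (a \<otimes> a')"
  "a \<in> carrier R \<Longrightarrow> a' \<in> carrier R \<Longrightarrow> a \<otimes> (r \<odot> a') = r \<odot> (a \<otimes> a')"
  "a \<in> carrier R \<Longrightarrow> 0 \<odot> a = \<zero>"
  "a \<in> carrier R \<Longrightarrow> 1 \<odot> a = a"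
  using Mod.smult_closed[of r a] Mod.smult_assoc1[of r r' a] Mod.smult_l_null[of a] Mod.smult_one[of a] k_algebra
  by (auto simp: k_algebra_def)

lemma coord_finsum:
  assumes "s \<in> S" "finite I" "f \<in> I \<rightarrow> carrier R"
  shows "coord s (finsum R f I) = (\<Sum>i\<in>I. coord s (f i))"
  using assms by (intro sum_additive) (auto simp: coord_add Alg.abelian_monoid_axioms)

lemma coord_combination:
  assumes "t \<in> S"
  shows "coord t (finsum R (\<lambda>s. c s \<odot> b s) S) = c t"
proof -
  have "coord t (finsum R (\<lambda>s. c s \<odot> b s) S) = (\<Sum>s\<in>S. coord t (c s \<odot> b s))"
    using assms fin by (intro coord_finsum) (auto simp: smult_simps b_closed)
  also have "\<dots> = (\<Sum>s\<in>S. if t = s then c s else 0)"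
    using assms by (intro sum.cong) (auto simp: coord_smult b_closed coord_b)
  finally show ?thesis using assms fin by simp
qed

lemma expansion:
  assumes "a \<in> carrier R"
  shows "a = finsum R (\<lambda>s. coord s a \<odot> b s) S"
proof -
  obtain c where c: "a = finsum R (\<lambda>s. c s \<odot> b s) S"
    using span[OF assms] by blast
  have "finsum R (\<lambda>s. c s \<odot> b s) S = finsum R (\<lambda>s. coord s a \<odot> b s) S"
    by (intro Alg.finsum_cong') (auto simp: c coord_combination smult_simps b_closed)
  then show ?thesis using c by simp
qed

lemma eq_by_coord:
  assumes "a \<in> carrier R" "a' \<in> carrier R" "\<And>s. s \<in> S \<Longrightarrow> coord s a = coord s a'"
  shows "a = a'"
proof -
  have "finsum R (\<lambda>s. coord s a \<odot> b s) S = finsum R (\<lambda>s. coord s a' \<odot> b s) S"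
    using assms by (intro Alg.finsum_cong') (auto simp: smult_simps b_closed)
  then show ?thesis using expansion assms by metis
qed

end

section \<open>Algebras whose homogeneous parts are lines\<close>

locale homogeneous_basis = coordinate_basis R S b coord
  for R :: "('k::field, 'a, 'z) module_scheme" (structure)
    and S :: "'g::ab_group_add set" and b coord +
  fixes \<theta> :: "'g \<Rightarrow> 'g \<Rightarrow> 'k" and gr :: "'g \<Rightarrow> 'a set"
  assumes subgrp: "add_subgroup S"
    and b_mult: "\<lbrakk>s \<in> S; t \<in> S\<rbrakk> \<Longrightarrow> b s \<otimes> b t = \<theta> s t \<odot> b (s + t)"
    and theta_nonzero: "\<lbrakk>s \<in> S; t \<in> S\<rbrakk> \<Longrightarrow> \<theta> s t \<noteq> 0"
    and grade: "s \<in> S \<Longrightarrow> gr s = {r \<odot> b s | r. True}"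
begin

lemma S_closed: "0 \<in> S" "\<lbrakk>s \<in> S; t \<in> S\<rbrakk> \<Longrightarrow> s + t \<in> S"
  using subgrp by (auto simp: add_subgroup_def)

text \<open>Expanding both factors in the basis leaves a multiple of \<open>b (s + t)\<close> for
  every pair. The indicator form of the sum becomes the product of \<open>twisted_group_ring\<close>
  once restricted to the pairs with sum \<open>g\<close>.\<close>

lemma coord_mult:
  assumes "g \<in> S" "a \<in> carrier R" "a' \<in> carrier R"
  shows "coord g (a \<otimes> a') =
    (\<Sum>s\<in>S. \<Sum>t\<in>S. if s + t = g then coord s a * coord t a' * \<theta> s t else 0)"
proof -
  have 1: "coord g (b s \<otimes> a') = (\<Sum>t\<in>S. if s + t = g then coord t a' * \<theta> s t else 0)"
    if s: "s \<in> S" for s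
  proof -
    have "b s \<otimes> a' = b s \<otimes> finsum R (\<lambda>t. coord t a' \<odot> b t) S"
      using expansion[OF assms(3)] by simp
    also have "\<dots> = finsum R (\<lambda>t. b s \<otimes> (coord t a' \<odot> b t)) S"
      using s fin by (intro Alg.finsum_rdistr) (auto simp: smult_simps b_closed)
    finally have "coord g (b s \<otimes> a') = (\<Sum>t\<in>S. coord g (b s \<otimes> (coord t a' \<odot> b t)))"
      using s fin assms(1) by (simp add: coord_finsum smult_simps b_closed Pi_def)
    also have "\<dots> = (\<Sum>t\<in>S. if s + t = g then coord t a' * \<theta> s t else 0)"
      using s assms(1)
      by (intro sum.cong) (auto simp: smult_simps b_closed b_mult coord_smult coord_b S_closed)
    finally show ?thesis .
  qed
  have "a \<otimes> a' = finsum R (\<lambda>s. coord s a \<odot> b s) S \<otimes> a'"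
    using expansion[OF assms(2)] by simp
  also have "\<dots> = finsum R (\<lambda>s. (coord s a \<odot> b s) \<otimes> a') S"
    using assms(3) fin by (intro Alg.finsum_ldistr) (auto simp: smult_simps b_closed)
  finally have "coord g (a \<otimes> a') = (\<Sum>s\<in>S. coord g ((coord s a \<odot> b s) \<otimes> a'))"
    using assms fin by (simp add: coord_finsum smult_simps b_closed Pi_def)
  also have "\<dots> = (\<Sum>s\<in>S. coord s a * coord g (b s \<otimes> a'))"
    using assms by (intro sum.cong) (auto simp: smult_simps b_closed coord_smult)
  also have "\<dots> = (\<Sum>s\<in>S. \<Sum>t\<in>S. if s + t = g then coord s a * coord t a' * \<theta> s t else 0)"
    by (intro sum.cong) (auto simp: 1 sum_distrib_left mult.assoc intro!: sum.cong)
  finally show ?thesis .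
qed

text \<open>The unit is found from \<open>\<one> \<otimes> b 0 = b 0\<close>: the coordinate at
  \<open>g\<close> of the left side is \<open>coord g \<one> * \<theta> g 0\<close>, which must be 1
  for \<open>g = 0\<close> and 0 otherwise. This is the origin of the factor
  \<open>inverse (\<theta> 0 0)\<close> in the unit of the twisted group ring.\<close>

lemma coord_one:
  assumes "g \<in> S"
  shows "coord g \<one> = (if g = 0 then inverse (\<theta> 0 0) else 0)"
proof -
  have "coord g (b 0) = coord g (\<one> \<otimes> b 0)"
    by (simp add: b_closed S_closed)
  also have "\<dots> = (\<Sum>s\<in>S. \<Sum>t\<in>S. if s + t = g then coord s \<one> * coord t (b 0) * \<theta> s t else 0)"
    using assms by (intro coord_mult) (auto simp: b_closed S_closed)
  \<comment> \<open>Only \<open>t = 0\<close> survives, because \<open>coord t (b 0)\<close> is a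
    Kronecker delta; then \<open>s + t = g\<close> forces \<open>s = g\<close>.\<close>
  also have "\<dots> = (\<Sum>s\<in>S. \<Sum>t\<in>S. if t = 0 then if s = g then coord s \<one> * \<theta> s t else 0 else 0)"
    by (intro sum.cong) (auto simp: coord_b S_closed)
  also have "\<dots> = coord g \<one> * \<theta> g 0"
    using assms fin S_closed by simp
  finally have "coord g \<one> * \<theta> g 0 = (if g = 0 then 1 else 0)"
    using assms S_closed by (simp add: coord_b)
  then show ?thesis
    using theta_nonzero[OF assms S_closed(1)] by (auto simp: field_simps)
qed

text \<open>The identity is associativity of \<open>R\<close> on three basis elements: both
  bracketings are multiples of \<open>b (s + t + u)\<close>, and the coordinate there compares the
  scalars.\<close>

lemma two_cocycle_theta: "two_cocycle S \<theta>"
  unfolding two_cocycle_def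
proof (intro conjI ballI)
  fix s t u assume S: "s \<in> S" "t \<in> S" "u \<in> S"
  have "(\<theta> s t * \<theta> (s + t) u) \<odot> b (s + t + u) = (b s \<otimes> b t) \<otimes> b u"
    using S by (simp add: b_mult smult_simps b_closed S_closed)
  also have "\<dots> = b s \<otimes> (b t \<otimes> b u)"
    using S by (intro Alg.m_assoc) (auto simp: b_closed)
  also have "\<dots> = (\<theta> t u * \<theta> s (t + u)) \<odot> b (s + t + u)"
    using S by (simp add: b_mult smult_simps b_closed S_closed add.assoc)
  finally have "coord (s + t + u) ((\<theta> s t * \<theta> (s + t) u) \<odot> b (s + t + u)) =
    coord (s + t + u) ((\<theta> t u * \<theta> s (t + u)) \<odot> b (s + t + u))"
    by simp
  then show "\<theta> s t * \<theta> (s + t) u = \<theta> t u * \<theta> s (t + u)"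
    using S by (simp add: coord_smult coord_b b_closed S_closed)
qed (simp add: theta_nonzero)

lemma submodule_grade:
  assumes "s \<in> S"
  shows "submodule (gr s) (ring_of_type_algebra :: 'k ring) R"
proof (rule Mod.submoduleI)
  note b = b_closed[OF assms]
  show "gr s \<subseteq> carrier R"
    using assms b by (auto simp: grade smult_simps)
  show "\<zero> \<in> gr s"
    using assms b smult_simps(5)[OF b] by (auto simp: grade intro!: exI[of _ 0])
  show "\<ominus> a \<in> gr s" if a: "a \<in> gr s" for a
  proof -
    obtain r where "a = r \<odot> b s" using a assms by (auto simp: grade)
    then have "\<ominus> a = (\<ominus>\<^bsub>ring_of_type_algebra\<^esub> r) \<odot> b s"
      using Mod.smult_l_minus[of r "b s"] b by simp
    then show ?thesis using assms by (auto simp: grade)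
  qed
  show "a \<oplus> a' \<in> gr s" if a: "a \<in> gr s" "a' \<in> gr s" for a a'
  proof -
    obtain r r' where "a = r \<odot> b s" "a' = r' \<odot> b s"
      using a unfolding grade[OF assms] by blast
    then have "a \<oplus> a' = (r + r') \<odot> b s"
      using Mod.smult_l_distr[of r r' "b s"] b by simp
    then show ?thesis using assms by (auto simp: grade)
  qed
  show "r \<odot> a \<in> gr s" if "a \<in> gr s" for r a
    using that assms b by (auto simp: grade smult_simps)
qed

lemma graded_k_algebra: "graded_k_algebra S R gr"
  unfolding graded_k_algebra_def
proof (intro conjI ballI)
  show "\<exists>!c. c \<in> (\<Pi>\<^sub>E s\<in>S. gr s) \<and> a = finsum R c S" if a: "a \<in> carrier R" for a
  proof (rule ex1I)
    \<comment> \<open>Restriction makes the family extensional, as the product set demands; without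
      it uniqueness would fail outside \<open>S\<close>.\<close>
    let ?c = "restrict (\<lambda>s. coord s a \<odot> b s) S"
    have "finsum R (\<lambda>s. coord s a \<odot> b s) S = finsum R ?c S"
      by (intro Alg.finsum_cong') (auto simp: smult_simps b_closed)
    then show "?c \<in> (\<Pi>\<^sub>E s\<in>S. gr s) \<and> a = finsum R ?c S"
      using expansion[OF a] by (auto simp: grade)
    fix c assume c: "c \<in> (\<Pi>\<^sub>E s\<in>S. gr s) \<and> a = finsum R c S"
    \<comment> \<open>Members of a grade are multiples of \<open>b s\<close>, and the coordinates of
      \<open>a\<close> recover the multipliers.\<close>
    then have "\<forall>s\<in>S. \<exists>r. c s = r \<odot> b s"
      using grade by (fastforce simp: PiE_iff)
    then obtain r where r: "\<And>s. s \<in> S \<Longrightarrow> c s = r s \<odot> b s"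
      by metis
    have "finsum R c S = finsum R (\<lambda>s. r s \<odot> b s) S"
      by (intro Alg.finsum_cong') (auto simp: smult_simps b_closed r)
    then have "coord s a = r s" if "s \<in> S" for s
      using that c coord_combination by simp
    then show "c = ?c"
      using c r by (intro extensionalityI[of _ S]) (auto simp: PiE_def)
  qed
next
  fix s t a a' assume *: "s \<in> S" "t \<in> S" "a \<in> gr s" "a' \<in> gr t"
  then obtain r r' where "a = r \<odot> b s" "a' = r' \<odot> b t"
    by (auto simp: grade)
  then have "a \<otimes> a' = (r * (r' * \<theta> s t)) \<odot> b (s + t)"
    using * by (simp add: smult_simps b_closed b_mult S_closed mult_ac)
  then show "a \<otimes> a' \<in> gr (s + t)"
    using * by (auto simp: grade S_closed)
qed (use fin subgrp k_algebra submodule_grade in auto)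

section \<open>The coordinate map to the twisted group ring\<close>

definition coords :: "'a \<Rightarrow> 'g \<Rightarrow> 'k" where
  "coords a g = (if g \<in> S then coord g a else 0)"

lemma coords_finsum:
  assumes "a \<in> carrier (twisted_group_ring S \<theta>)"
  shows "coords (finsum R (\<lambda>s. a s \<odot> b s) S) = a"
  using assms by (auto simp: coords_def coord_combination twisted_group_ring_def)

text \<open>Multiplicativity is \<open>coord_mult\<close>, injectivity is
  \<open>eq_by_coord\<close>, and surjectivity comes from the combination with prescribed
  coefficients. Elements of the target vanish outside \<open>S\<close>, which is why
  \<open>coords\<close> is 0 there.\<close>

lemma coords_ring_iso: "coords \<in> ring_iso R (twisted_group_ring S \<theta>)"
proof (rule ring_iso_memI)
  show "coords a \<in> carrier (twisted_group_ring S \<theta>)" for a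
    by (auto simp: coords_def twisted_group_ring_def)
  show "coords (a \<oplus> a') = coords a \<oplus>\<^bsub>twisted_group_ring S \<theta>\<^esub> coords a'"
    if "a \<in> carrier R" "a' \<in> carrier R" for a a'
    using that by (auto simp: coords_def twisted_group_ring_def coord_add)
  show "coords \<one> = \<one>\<^bsub>twisted_group_ring S \<theta>\<^esub>"
    by (auto simp: coords_def twisted_group_ring_def coord_one twisted_basis_def S_closed)
  show "coords (a \<otimes> a') = coords a \<otimes>\<^bsub>twisted_group_ring S \<theta>\<^esub> coords a'"
    if a: "a \<in> carrier R" "a' \<in> carrier R" for a a'
  proof
    fix g
    let ?P = "{(s, t). s \<in> S \<and> t \<in> S \<and> s + t = g}"
    let ?f = "\<lambda>(s, t). coords a s * coords a' t * \<theta> s t"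
    have "sum ?f ?P = (\<Sum>p\<in>S \<times> S. if fst p + snd p = g then ?f p else 0)"
      using fin by (intro sum.mono_neutral_cong_left) auto
    also have "\<dots> = (\<Sum>s\<in>S. \<Sum>t\<in>S. if s + t = g then coords a s * coords a' t * \<theta> s t else 0)"
      unfolding sum.cartesian_product by (intro sum.cong) auto
    also have "\<dots> = coords (a \<otimes> a') g"
    proof (cases "g \<in> S")
      case True
      then show ?thesis
        using a by (auto simp: coord_mult coords_def intro!: sum.cong)
    next
      case False
      \<comment> \<open>\<open>S\<close> is closed under addition, so no pair contributes to a value
        outside \<open>S\<close>.\<close>
      then have "s + t \<noteq> g" if "s \<in> S" "t \<in> S" for s t
        using that S_closed by auto
      then show ?thesis using False by (simp add: coords_def)
    qed
    finally show "coords (a \<otimes> a') g = (coords a \<otimes>\<^bsub>twisted_group_ring S \<theta>\<^esub> coords a') g"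
      by (simp add: twisted_group_ring_def)
  qed
  show "bij_betw coords (carrier R) (carrier (twisted_group_ring S \<theta>))"
    unfolding bij_betw_def
  proof
    show "inj_on coords (carrier R)"
      by (rule inj_onI, rule eq_by_coord) (auto simp: coords_def fun_eq_iff split: if_splits)
    show "coords ` carrier R = carrier (twisted_group_ring S \<theta>)"
    proof (intro subset_antisym subsetI)
      fix a assume "a \<in> carrier (twisted_group_ring S \<theta>)"
      from coords_finsum[OF this, symmetric] show "a \<in> coords ` carrier R"
        by (rule image_eqI) (auto simp: smult_simps b_closed intro!: Alg.finsum_closed)
    qed (auto simp: coords_def twisted_group_ring_def)
  qed
qed

text \<open>The ring axioms are transported from \<open>R\<close> along \<open>coords\<close>, so
  associativity of the twisted product is never computed from the cocycle identity. Only the module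
  laws and the compatibility with scalars are checked on functions.\<close>

lemma k_algebra_twisted_group_ring: "k_algebra (twisted_group_ring S \<theta>)"
proof -
  \<comment> \<open>Transport along a ring isomorphism gives a ring whose zero is the image of zero;
    this identifies it with the zero function.\<close>
  have zero: "coords \<zero> = \<zero>\<^bsub>twisted_group_ring S \<theta>\<^esub>"
    using coord_smult[of _ "\<zero>" 0]
    by (auto simp: coords_def twisted_group_ring_def smult_simps)
  have ring: "ring (twisted_group_ring S \<theta>)"
    using Alg.ring_iso_imp_img_ring[OF coords_ring_iso]
    by (simp add: zero)
  then interpret T: ring "twisted_group_ring S \<theta>" .
  have "module (ring_of_type_algebra :: 'k ring) (twisted_group_ring S \<theta>)"
    by (rule moduleI, rule cring_from_type_algebra, rule T.abelian_group_axioms)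
      (auto simp: twisted_group_ring_def algebra_simps)
  moreover have "r \<odot>\<^bsub>twisted_group_ring S \<theta>\<^esub> a \<otimes>\<^bsub>twisted_group_ring S \<theta>\<^esub> a' =
      r \<odot>\<^bsub>twisted_group_ring S \<theta>\<^esub> (a \<otimes>\<^bsub>twisted_group_ring S \<theta>\<^esub> a') \<and>
    a \<otimes>\<^bsub>twisted_group_ring S \<theta>\<^esub> (r \<odot>\<^bsub>twisted_group_ring S \<theta>\<^esub> a') =
      r \<odot>\<^bsub>twisted_group_ring S \<theta>\<^esub> (a \<otimes>\<^bsub>twisted_group_ring S \<theta>\<^esub> a')" for r a a'
    by (auto simp: twisted_group_ring_def sum_distrib_left mult_ac case_prod_unfold)
  ultimately show ?thesis
    using ring by (simp add: k_algebra_def)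
qed

text \<open>With evaluation as coordinates the target is an instance of the same locale, so its
  grading comes from \<open>graded_k_algebra\<close> as well.\<close>

lemma twisted_group_ring_basis:
  "homogeneous_basis (twisted_group_ring S \<theta>) S twisted_basis (\<lambda>g a. a g) \<theta> twisted_grade"
proof (unfold_locales, goal_cases)
  \<comment> \<open>Goal 7 is \<open>span\<close>: the coefficients of \<open>a\<close> are its
    values, since evaluation at \<open>g\<close> is additive.\<close>
  case (7 a)
  let ?T = "twisted_group_ring S \<theta>"
  interpret T: ring ?T
    using k_algebra_twisted_group_ring by (simp add: k_algebra_def)
  have "a g = finsum ?T (\<lambda>s. a s \<odot>\<^bsub>?T\<^esub> twisted_basis s) S g" for g
  proof -
    have "finsum ?T (\<lambda>s. a s \<odot>\<^bsub>?T\<^esub> twisted_basis s) S g =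
      (\<Sum>s\<in>S. (a s \<odot>\<^bsub>?T\<^esub> twisted_basis s) g)"
      using fin
      by (intro sum_additive[where h = "\<lambda>a. a g"] T.abelian_monoid_axioms)
        (auto simp: twisted_group_ring_def twisted_basis_def)
    also have "\<dots> = (\<Sum>s\<in>S. if s = g then a s else 0)"
      by (intro sum.cong) (auto simp: twisted_group_ring_def twisted_basis_def)
    also have "\<dots> = a g"
      using 7 fin by (auto simp: twisted_group_ring_def)
    finally show ?thesis ..
  qed
  then show ?case by blast
next
  \<comment> \<open>Goal 11 is \<open>grade\<close>.\<close>
  case (11 s)
  then show ?case by (auto simp: twisted_grade_def twisted_group_ring_def)
qed (use twisted_basis_mult k_algebra_twisted_group_ring fin subgrp theta_nonzero in
  \<open>auto simp: twisted_group_ring_def twisted_basis_def\<close>)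

lemma graded_iso:
  "graded_k_algebra_iso S R gr (twisted_group_ring S \<theta>) twisted_grade coords"
  unfolding graded_k_algebra_iso_def
proof (intro conjI ballI allI)
  show smult: "coords (r \<odot> a) = r \<odot>\<^bsub>twisted_group_ring S \<theta>\<^esub> coords a" if "a \<in> carrier R" for r a
    using that by (auto simp: coords_def twisted_group_ring_def coord_smult)
  show "coords ` gr s = twisted_grade s" if "s \<in> S" for s
  proof -
    have "coords (b s) = twisted_basis s"
      using that by (auto simp: coords_def twisted_basis_def coord_b)
    then have "coords (r \<odot> b s) = (\<lambda>g. r * twisted_basis s g)" for r
      using that by (simp add: smult b_closed) (simp add: twisted_group_ring_def)
    then show ?thesis
      using that by (simp add: grade twisted_grade_def full_SetCompr_eq image_image)
  qed
qed (use graded_k_algebra coords_ring_iso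
  homogeneous_basis.graded_k_algebra[OF twisted_group_ring_basis] in auto)

end

section \<open>Linear monoidal categories\<close>

text \<open>Conditions on \<open>Arr\<close>, \<open>Dom\<close> and \<open>Cod\<close> turn the
  typing of arrows into side conditions that simplification can discharge; the axioms are restated
  in that form below.\<close>

lemma Hom_iff: "f \<in> Hom C a b \<longleftrightarrow> f \<in> Arr C \<and> Dom C f = a \<and> Cod C f = b"
  by (auto simp: Hom_def)

section \<open>Isomorphisms in a category\<close>

context category
begin

lemma Ident_arr [simp]:
  assumes "a \<in> Obj C"
  shows "Ident C a \<in> Arr C" "Dom C (Ident C a) = a" "Cod C (Ident C a) = a"
  using Ident_Hom[OF assms] by (auto simp: Hom_iff)

lemma Comp_arr [simp]:
  assumes "f \<in> Arr C" "g \<in> Arr C" "Cod C f = Dom C g"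
  shows "g \<bullet> f \<in> Arr C" "Dom C (g \<bullet> f) = Dom C f" "Cod C (g \<bullet> f) = Cod C g"
  using Comp_Hom[of f "Dom C f" "Dom C g" g "Cod C g"] assms by (auto simp: Hom_iff)

lemma Dom_Cod_Obj [simp]: "f \<in> Arr C \<Longrightarrow> Dom C f \<in> Obj C" "f \<in> Arr C \<Longrightarrow> Cod C f \<in> Obj C"
  by (simp_all add: Dom_Obj Cod_Obj)

lemma Hom_Obj: "f \<in> Hom C a b \<Longrightarrow> a \<in> Obj C" "f \<in> Hom C a b \<Longrightarrow> b \<in> Obj C"
  by (auto simp: Hom_iff)

lemma Comp_Ident [simp]:
  "f \<in> Arr C \<Longrightarrow> Dom C f = a \<Longrightarrow> f \<bullet> Ident C a = f"
  "f \<in> Arr C \<Longrightarrow> Cod C f = a \<Longrightarrow> Ident C a \<bullet> f = f"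
  using Comp_Ident_right[of f "Dom C f" "Cod C f"] Comp_Ident_left[of f "Dom C f" "Cod C f"]
  by (auto simp: Hom_iff)

lemma Comp_assoc_arr [simp]:
  "\<lbrakk>f \<in> Arr C; g \<in> Arr C; h \<in> Arr C; Cod C f = Dom C g; Cod C g = Dom C h\<rbrakk> \<Longrightarrow>
    (h \<bullet> g) \<bullet> f = h \<bullet> (g \<bullet> f)"
  by (rule Comp_assoc) (auto simp: Hom_iff)

lemma iso_arr_Hom: "iso_arr C a b f \<Longrightarrow> f \<in> Hom C a b"
  by (simp add: iso_arr_def)

lemma iso_arrE:
  assumes "iso_arr C a b f"
  obtains g where "iso_arr C b a g" "f \<in> Hom C a b" "g \<in> Hom C b a"
    "g \<bullet> f = Ident C a" "f \<bullet> g = Ident C b"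
  using assms unfolding iso_arr_def by blast

lemma iso_arr_Ident: "a \<in> Obj C \<Longrightarrow> iso_arr C a a (Ident C a)"
  unfolding iso_arr_def by (auto intro!: bexI[of _ "Ident C a"] simp: Hom_iff)

lemma iso_arr_Comp:
  assumes "iso_arr C a b f" "iso_arr C b c g"
  shows "iso_arr C a c (g \<bullet> f)"
proof -
  obtain f' where f: "f \<in> Hom C a b" "f' \<in> Hom C b a" "f' \<bullet> f = Ident C a" "f \<bullet> f' = Ident C b"
    using assms(1) by (rule iso_arrE)
  obtain g' where g: "g \<in> Hom C b c" "g' \<in> Hom C c b" "g' \<bullet> g = Ident C b" "g \<bullet> g' = Ident C c"
    using assms(2) by (rule iso_arrE)
  have "f' \<bullet> g' \<bullet> g \<bullet> f = f' \<bullet> (g' \<bullet> g) \<bullet> f" "g \<bullet> f \<bullet> f' \<bullet> g' = g \<bullet> (f \<bullet> f') \<bullet> g'"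
    using f(1,2) g(1,2) by (auto simp: Hom_iff)
  then have "f' \<bullet> g' \<bullet> g \<bullet> f = Ident C a" "g \<bullet> f \<bullet> f' \<bullet> g' = Ident C c"
    using f g by (auto simp: Hom_iff)
  then show ?thesis
    using f(1,2) g(1,2) unfolding iso_arr_def by (auto intro!: bexI[of _ "f' \<bullet> g'"] simp: Hom_iff)
qed

lemma iso_arr_cancel_left:
  assumes "iso_arr C b c f" "g \<in> Hom C a b" "h \<in> Hom C a b" "f \<bullet> g = f \<bullet> h"
  shows "g = h"
proof -
  obtain f' where f: "f \<in> Hom C b c" "f' \<in> Hom C c b" "f' \<bullet> f = Ident C b"
    using assms(1) by (rule iso_arrE)
  have "(f' \<bullet> f) \<bullet> g = (f' \<bullet> f) \<bullet> h"
    using f(1,2) assms(2-4) by (simp add: Hom_iff)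
  then show ?thesis using f assms(2,3) by (simp add: Hom_iff)
qed

lemma iso_arr_cancel_right:
  assumes "iso_arr C a b f" "g \<in> Hom C b c" "h \<in> Hom C b c" "g \<bullet> f = h \<bullet> f"
  shows "g = h"
proof -
  obtain f' where f: "f \<in> Hom C a b" "f' \<in> Hom C b a" "f \<bullet> f' = Ident C b"
    using assms(1) by (rule iso_arrE)
  have "(g \<bullet> f) \<bullet> f' = (h \<bullet> f) \<bullet> f'"
    using assms(4) by simp
  then have "g \<bullet> (f \<bullet> f') = h \<bullet> (f \<bullet> f')"
    using f(1,2) assms(2,3) by (simp add: Hom_iff)
  then show ?thesis using f assms(2,3) by (simp add: Hom_iff)
qed

lemma iso_arr_Comp_left_iff:
  assumes "iso_arr C b c f" "g \<in> Hom C a b"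
  shows "iso_arr C a c (f \<bullet> g) \<longleftrightarrow> iso_arr C a b g"
proof
  assume fg: "iso_arr C a c (f \<bullet> g)"
  obtain f' where f: "iso_arr C c b f'" "f \<in> Hom C b c" "f' \<in> Hom C c b" "f' \<bullet> f = Ident C b"
    using assms(1) by (rule iso_arrE)
  have "f' \<bullet> f \<bullet> g = (f' \<bullet> f) \<bullet> g"
    using f(2,3) assms(2) by (simp add: Hom_iff)
  then have "f' \<bullet> f \<bullet> g = g"
    using f(4) assms(2) by (simp add: Hom_iff)
  then show "iso_arr C a b g"
    using iso_arr_Comp[OF fg f(1)] by simp
qed (rule iso_arr_Comp[OF _ assms(1)])

lemma iso_arr_Comp_right_iff:
  assumes "iso_arr C a b f" "g \<in> Hom C b c"
  shows "iso_arr C a c (g \<bullet> f) \<longleftrightarrow> iso_arr C b c g"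
proof
  assume gf: "iso_arr C a c (g \<bullet> f)"
  obtain f' where f: "iso_arr C b a f'" "f \<in> Hom C a b" "f' \<in> Hom C b a" "f \<bullet> f' = Ident C b"
    using assms(1) by (rule iso_arrE)
  have "(g \<bullet> f) \<bullet> f' = g"
    using f(2-4) assms(2) by (simp add: Hom_iff)
  then show "iso_arr C b c g"
    using iso_arr_Comp[OF f(1) gf] by simp
qed (rule iso_arr_Comp[OF assms(1)])

lemma iso_obj_sym: "iso_obj C a b \<Longrightarrow> iso_obj C b a"
  unfolding iso_obj_def by (blast elim: iso_arrE)

lemma iso_obj_trans: "iso_obj C a b \<Longrightarrow> iso_obj C b c \<Longrightarrow> iso_obj C a c"
  unfolding iso_obj_def by (blast intro: iso_arr_Comp)

end

lemma hom_space_sel [simp]: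
  "carrier (hom_space C a b) = Hom C a b"
  "f \<otimes>\<^bsub>hom_space C a b\<^esub> g = f \<bullet>\<^bsub>C\<^esub> g"
  "\<one>\<^bsub>hom_space C a b\<^esub> = Ident C a"
  "\<zero>\<^bsub>hom_space C a b\<^esub> = Zero C a b"
  "f \<oplus>\<^bsub>hom_space C a b\<^esub> g = Add C f g"
  "r \<odot>\<^bsub>hom_space C a b\<^esub> f = Scale C r f"
  by (simp_all add: hom_space_def)

section \<open>Hom spaces as vector spaces\<close>

context linear_category
begin

lemma Zero_Hom:
  assumes "a \<in> Obj C" "b \<in> Obj C"
  shows "Zero C a b \<in> Hom C a b"
proof -
  interpret H: module "ring_of_type_algebra :: 'k ring" "hom_space C a b"
    by (rule hom_space_module[OF assms])
  show ?thesis using H.M.zero_closed by simp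
qed

lemma hom_space_abelian_group:
  assumes "a \<in> Obj C" "b \<in> Obj C"
  shows "abelian_group (hom_space C a b)"
  using hom_space_module[OF assms] by (simp add: module_def)

lemma hom_space_abelian_monoid:
  assumes "a \<in> Obj C" "b \<in> Obj C"
  shows "abelian_monoid (hom_space C a b)"
  using hom_space_abelian_group[OF assms] by (simp add: abelian_group_def)

lemma hom_facts:
  assumes "f \<in> Hom C a b"
  shows Scale_Hom: "Scale C r f \<in> Hom C a b"
    and Add_Hom: "f' \<in> Hom C a b \<Longrightarrow> Add C f f' \<in> Hom C a b"
    and Scale_zero: "Scale C 0 f = Zero C a b"
    and Scale_one: "Scale C 1 f = f"
    and Scale_Scale: "Scale C r (Scale C r' f) = Scale C (r * r') f"
    and Scale_add: "Scale C (r + r') f = Add C (Scale C r f) (Scale C r' f)"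
    and Scale_Zero: "Scale C r (Zero C a b) = Zero C a b"
proof -
  interpret H: module "ring_of_type_algebra :: 'k ring" "hom_space C a b"
    by (rule hom_space_module[OF Hom_Obj[OF assms]])
  show "Scale C r f \<in> Hom C a b" "f' \<in> Hom C a b \<Longrightarrow> Add C f f' \<in> Hom C a b"
    "Scale C 0 f = Zero C a b" "Scale C 1 f = f"
    "Scale C r (Scale C r' f) = Scale C (r * r') f"
    "Scale C (r + r') f = Add C (Scale C r f) (Scale C r' f)"
    "Scale C r (Zero C a b) = Zero C a b"
    using H.smult_closed[of r f] H.M.add.m_closed[of f f'] H.smult_l_null[of f] H.smult_one[of f]
      H.smult_assoc1[of r r' f] H.smult_l_distr[of r r' f] H.smult_r_null[of r] assms
    by auto
qed

text \<open>If \<open>r\<close> and \<open>r'\<close> differed, \<open>f\<close> would be killed by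
  \<open>r - r'\<close>, and multiplying by the inverse of this scalar would make \<open>f\<close>
  zero.\<close>

lemma Scale_inject:
  assumes f: "f \<in> Hom C a b" "f \<noteq> Zero C a b" and eq: "Scale C r f = Scale C r' f"
  shows "r = r'"
proof (rule ccontr)
  assume "r \<noteq> r'"
  interpret H: module "ring_of_type_algebra :: 'k ring" "hom_space C a b"
    by (rule hom_space_module[OF Hom_Obj[OF f(1)]])
  have "Add C (Scale C (r - r') f) (Scale C r' f) = Scale C r' f"
    using Scale_add[OF f(1), of "r - r'" r'] eq by simp
  then have "Scale C (r - r') f = Zero C a b"
    using H.M.add.r_cancel_one'[of "Scale C r' f" "Scale C (r - r') f"] Scale_Hom[OF f(1)] by simp
  then have "Scale C (inverse (r - r') * (r - r')) f = Zero C a b"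
    using Scale_Scale[OF f(1), of "inverse (r - r')" "r - r'"] Scale_Zero[OF f(1)] by simp
  then show False
    using f \<open>r \<noteq> r'\<close> Scale_one[OF f(1)] by simp
qed

text \<open>The zero morphism is 0 times itself, so compatibility of composition with scalars
  suffices.\<close>

lemma Comp_Zero_right:
  assumes "g \<in> Hom C b c" "a \<in> Obj C"
  shows "g \<bullet> Zero C a b = Zero C a c"
proof -
  have Z: "Zero C a b \<in> Hom C a b"
    using assms by (intro Zero_Hom) (auto simp: Hom_iff)
  have "g \<bullet> Scale C 0 (Zero C a b) = Scale C 0 (g \<bullet> Zero C a b)"
    using Z assms(1) by (rule Comp_Scale_right)
  then show ?thesis
    using Scale_zero[OF Z] Scale_zero[OF Comp_Hom[OF Z assms(1)]] by simp
qed

lemma Comp_Zero_left: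
  assumes "f \<in> Hom C a b" "c \<in> Obj C"
  shows "Zero C b c \<bullet> f = Zero C a c"
proof -
  have Z: "Zero C b c \<in> Hom C b c"
    using assms by (intro Zero_Hom) (auto simp: Hom_iff)
  have "Scale C 0 (Zero C b c) \<bullet> f = Scale C 0 (Zero C b c \<bullet> f)"
    using assms(1) Z by (rule Comp_Scale_left)
  then show ?thesis
    using Scale_zero[OF Z] Scale_zero[OF Comp_Hom[OF assms(1) Z]] by simp
qed

lemma Scale_arr [simp]:
  assumes "f \<in> Arr C"
  shows "Scale C r f \<in> Arr C" "Dom C (Scale C r f) = Dom C f" "Cod C (Scale C r f) = Cod C f"
    "Scale C 0 f = Zero C (Dom C f) (Cod C f)" "Scale C 1 f = f"
    "Scale C r (Scale C r' f) = Scale C (r * r') f"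
  using hom_facts[of f "Dom C f" "Cod C f"] assms by (auto simp: Hom_iff)

lemma Zero_arr [simp]:
  assumes "a \<in> Obj C" "b \<in> Obj C"
  shows "Zero C a b \<in> Arr C" "Dom C (Zero C a b) = a" "Cod C (Zero C a b) = b"
  using Zero_Hom[OF assms] by (auto simp: Hom_iff)

lemma Comp_Scale_arr [simp]:
  assumes "f \<in> Arr C" "g \<in> Arr C" "Cod C f = Dom C g"
  shows "g \<bullet> Scale C r f = Scale C r (g \<bullet> f)" "Scale C r g \<bullet> f = Scale C r (g \<bullet> f)"
  using Comp_Scale_left[of f _ _ g] Comp_Scale_right[of f _ _ g] assms by (auto simp: Hom_iff)

lemma Comp_Zero_arr [simp]:
  assumes "f \<in> Arr C" "c \<in> Obj C"
  shows "Cod C f = b \<Longrightarrow> Zero C b c \<bullet> f = Zero C (Dom C f) c"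
    "Dom C f = b \<Longrightarrow> f \<bullet> Zero C c b = Zero C c (Cod C f)"
  using Comp_Zero_left[of f _ _ c] Comp_Zero_right[of f _ _ c] assms by (auto simp: Hom_iff)

lemma finsum_Comp:
  assumes "finite I" "\<And>i. i \<in> I \<Longrightarrow> h i \<in> Hom C b c" "f \<in> Hom C a b" "c \<in> Obj C"
  shows "finsum (hom_space C b c) h I \<bullet> f = finsum (hom_space C a c) (\<lambda>i. h i \<bullet> f) I"
proof (rule finsum_additive)
  show "abelian_monoid (hom_space C b c)" "abelian_monoid (hom_space C a c)"
    using assms by (auto intro!: hom_space_abelian_monoid simp: Hom_iff)
qed (use assms in \<open>auto simp: Comp_Zero_left Comp_Add_left Comp_Hom\<close>)

lemma iso_arr_nonzero:
  assumes "iso_arr C a b f" "\<not> zero_obj C a"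
  shows "f \<noteq> Zero C a b"
proof
  assume "f = Zero C a b"
  obtain g where g: "f \<in> Hom C a b" "g \<in> Hom C b a" "g \<bullet> f = Ident C a"
    using assms(1) by (rule iso_arrE)
  then have "Ident C a = Zero C a a"
    using Comp_Zero_right[OF g(2)] \<open>f = Zero C a b\<close> by (auto simp: Hom_iff)
  then show False using assms(2) g(1) by (auto simp: zero_obj_def Hom_iff)
qed

lemma iso_arr_Scale:
  assumes "iso_arr C a b f" "r \<noteq> 0"
  shows "iso_arr C a b (Scale C r f)"
proof -
  obtain g where g: "f \<in> Hom C a b" "g \<in> Hom C b a" "g \<bullet> f = Ident C a" "f \<bullet> g = Ident C b"
    using assms(1) by (rule iso_arrE)
  have "Scale C (inverse r) g \<bullet> Scale C r f = Ident C a"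
    "Scale C r f \<bullet> Scale C (inverse r) g = Ident C b"
    using g assms(2) by (auto simp: Hom_iff)
  then show ?thesis
    using Scale_Hom[OF g(1)] Scale_Hom[OF g(2)] unfolding iso_arr_def by blast
qed

lemma hom_line_basis_nonzero:
  assumes "hom_one_dim C a b" "g \<in> Hom C a b" "g \<noteq> Zero C a b"
  shows "hom_line_basis C a b g"
  unfolding hom_line_basis_def
proof (intro conjI ballI)
  obtain f where f: "f \<in> Hom C a b" "\<And>h. h \<in> Hom C a b \<Longrightarrow> \<exists>r. h = Scale C r f"
    using assms(1) by (auto simp: hom_one_dim_def hom_line_basis_def)
  obtain r where r: "g = Scale C r f"
    using f(2)[OF assms(2)] by blast
  then have "r \<noteq> 0" using assms(3) Scale_zero[OF f(1)] by auto
  fix h assume "h \<in> Hom C a b"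
  then obtain q where "h = Scale C q f" using f(2) by blast
  then have "h = Scale C (q * inverse r) g"
    using r f(1) \<open>r \<noteq> 0\<close> by (simp add: Scale_Scale mult.assoc)
  then show "\<exists>r. h = Scale C r g" ..
qed fact+

text \<open>Some isomorphism is a multiple of \<open>f\<close>, with nonzero coefficient because an
  isomorphism out of a nonzero object is nonzero. It is applied to \<open>lam i j\<close>, which is
  given as a basis vector and not as an isomorphism.\<close>

lemma hom_line_basis_iso:
  assumes "hom_line_basis C a b f" "iso_obj C a b"
  shows "iso_arr C a b f"
proof -
  have f: "f \<in> Hom C a b" "f \<noteq> Zero C a b"
    using assms(1) by (auto simp: hom_line_basis_def)
  obtain g where g: "iso_arr C a b g"
    using assms(2) by (auto simp: iso_obj_def)
  then obtain r where r: "g = Scale C r f"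
    using assms(1) by (auto simp: hom_line_basis_def dest: iso_arr_Hom)
  \<comment> \<open>Only the zero morphism leaves a zero object, but \<open>f\<close> is
    nonzero.\<close>
  have "\<not> zero_obj C a"
  proof
    assume "zero_obj C a"
    then have "f = Zero C a b"
      using f(1) Comp_Zero_right[OF f(1), of a] Comp_Ident_right[OF f(1)] by (simp add: zero_obj_def)
    then show False using f(2) by simp
  qed
  then have "r \<noteq> 0"
    using iso_arr_nonzero[OF g] Scale_zero[OF f(1)] r by auto
  then have "f = Scale C (inverse r) g"
    using f(1) r by (simp add: Scale_Scale Scale_one)
  then show ?thesis
    using iso_arr_Scale[OF g, of "inverse r"] \<open>r \<noteq> 0\<close> by simp
qed

text \<open>Meaningful where \<open>v\<close> is a basis of a line containing \<open>h\<close>: the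
  scalar then exists and is unique by \<open>Scale_inject\<close>.\<close>

definition line_coeff :: "'m \<Rightarrow> 'm \<Rightarrow> 'k" where
  "line_coeff v h = (THE r. h = Scale C r v)"

lemma line_coeff_eq:
  assumes "hom_line_basis C a b v"
  shows "line_coeff v (Scale C r v) = r"
  unfolding line_coeff_def
  using assms by (intro the_equality) (auto simp: hom_line_basis_def dest: Scale_inject)

lemma line_coeff_Scale:
  assumes "hom_line_basis C a b v" "h \<in> Hom C a b"
  shows "line_coeff v (Scale C r h) = r * line_coeff v h"
proof -
  obtain q where "h = Scale C q v"
    using assms by (auto simp: hom_line_basis_def)
  then show ?thesis
    using assms(1) line_coeff_eq[OF assms(1)] by (auto simp: hom_line_basis_def Scale_Scale)
qed

lemma line_coeff_Add:
  assumes "hom_line_basis C a b v" "h \<in> Hom C a b" "h' \<in> Hom C a b"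
  shows "line_coeff v (Add C h h') = line_coeff v h + line_coeff v h'"
proof -
  obtain q q' where q: "h = Scale C q v" "h' = Scale C q' v"
    using assms unfolding hom_line_basis_def by blast
  moreover have "v \<in> Hom C a b" using assms(1) by (simp add: hom_line_basis_def)
  ultimately have "Add C h h' = Scale C (q + q') v"
    by (simp add: Scale_add)
  then show ?thesis
    using q line_coeff_eq[OF assms(1)] by simp
qed

end

section \<open>Bilinearity and naturality of the tensor product\<close>

context linear_abelian_monoidal_category
begin

lemma TensorO_Obj_simp [simp]: "a \<in> Obj C \<Longrightarrow> b \<in> Obj C \<Longrightarrow> a \<otimes>\<^sub>O b \<in> Obj C"
  by (rule TensorO_Obj)

lemma TensorM_arr [simp]:
  assumes "f \<in> Arr C" "g \<in> Arr C"
  shows "f \<otimes>\<^sub>M g \<in> Arr C" "Dom C (f \<otimes>\<^sub>M g) = Dom C f \<otimes>\<^sub>O Dom C g"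
    "Cod C (f \<otimes>\<^sub>M g) = Cod C f \<otimes>\<^sub>O Cod C g"
  using TensorM_Hom[of f "Dom C f" "Cod C f" g "Dom C g" "Cod C g"] assms by (auto simp: Hom_iff)

lemma Unit_Obj_simp [simp]: "Unit C \<in> Obj C"
  by (rule Unit_Obj)

lemma Assoc_arr [simp]:
  assumes "a \<in> Obj C" "b \<in> Obj C" "c \<in> Obj C"
  shows "Assoc C a b c \<in> Arr C" "Dom C (Assoc C a b c) = a \<otimes>\<^sub>O b \<otimes>\<^sub>O c"
    "Cod C (Assoc C a b c) = a \<otimes>\<^sub>O (b \<otimes>\<^sub>O c)"
  using iso_arr_Hom[OF Assoc_iso[OF assms]] by (auto simp: Hom_iff)

lemma Unitor_arr [simp]:
  assumes "a \<in> Obj C"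
  shows "LUnitor C a \<in> Arr C" "Dom C (LUnitor C a) = Unit C \<otimes>\<^sub>O a" "Cod C (LUnitor C a) = a"
    "RUnitor C a \<in> Arr C" "Dom C (RUnitor C a) = a \<otimes>\<^sub>O Unit C" "Cod C (RUnitor C a) = a"
  using iso_arr_Hom[OF LUnitor_iso[OF assms]] iso_arr_Hom[OF RUnitor_iso[OF assms]]
  by (auto simp: Hom_iff)

lemma TensorM_Comp_arr:
  assumes "f \<in> Arr C" "f' \<in> Arr C" "Cod C f = Dom C f'" "g \<in> Arr C" "g' \<in> Arr C" "Cod C g = Dom C g'"
  shows "(f' \<otimes>\<^sub>M g') \<bullet> (f \<otimes>\<^sub>M g) = (f' \<bullet> f) \<otimes>\<^sub>M (g' \<bullet> g)"
  using TensorM_Comp[of f _ _ f' _ g _ _ g'] assms by (simp add: Hom_iff)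

text \<open>Composites are normalised to right-nested form, in which two adjacent tensor products
  may have a further arrow to their right. The primed rules carry that arrow.\<close>

lemma TensorM_Comp_arr':
  assumes "f \<in> Arr C" "f' \<in> Arr C" "Cod C f = Dom C f'" "g \<in> Arr C" "g' \<in> Arr C" "Cod C g = Dom C g'"
    "h \<in> Arr C" "Cod C h = Dom C f \<otimes>\<^sub>O Dom C g"
  shows "(f' \<otimes>\<^sub>M g') \<bullet> (f \<otimes>\<^sub>M g) \<bullet> h = ((f' \<bullet> f) \<otimes>\<^sub>M (g' \<bullet> g)) \<bullet> h"
  using assms by (simp add: TensorM_Comp_arr flip: Comp_assoc_arr)

lemma Assoc_natural_arr:
  assumes "f \<in> Arr C" "g \<in> Arr C" "h \<in> Arr C" "Cod C f = a" "Cod C g = b" "Cod C h = c"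
  shows "Assoc C a b c \<bullet> (f \<otimes>\<^sub>M g \<otimes>\<^sub>M h) =
    (f \<otimes>\<^sub>M (g \<otimes>\<^sub>M h)) \<bullet> Assoc C (Dom C f) (Dom C g) (Dom C h)"
  using assms by (intro Assoc_natural) (auto simp: Hom_iff)

lemma Assoc_natural_arr':
  assumes "f \<in> Arr C" "g \<in> Arr C" "h \<in> Arr C" "Cod C f = a" "Cod C g = b" "Cod C h = c"
    "k \<in> Arr C" "Cod C k = Dom C f \<otimes>\<^sub>O Dom C g \<otimes>\<^sub>O Dom C h"
  shows "Assoc C a b c \<bullet> (f \<otimes>\<^sub>M g \<otimes>\<^sub>M h) \<bullet> k =
    (f \<otimes>\<^sub>M (g \<otimes>\<^sub>M h)) \<bullet> Assoc C (Dom C f) (Dom C g) (Dom C h) \<bullet> k"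
proof -
  have "(Assoc C a b c \<bullet> (f \<otimes>\<^sub>M g \<otimes>\<^sub>M h)) \<bullet> k =
    ((f \<otimes>\<^sub>M (g \<otimes>\<^sub>M h)) \<bullet> Assoc C (Dom C f) (Dom C g) (Dom C h)) \<bullet> k"
    using Assoc_natural_arr[OF assms(1-6)] by simp
  moreover have "a \<in> Obj C" "b \<in> Obj C" "c \<in> Obj C" using assms by auto
  ultimately show ?thesis using assms by simp
qed

lemmas monoidal_simps = TensorM_Comp_arr TensorM_Comp_arr' Assoc_natural_arr Assoc_natural_arr'

lemma TensorM_Ident_arr [simp]:
  "a \<in> Obj C \<Longrightarrow> b \<in> Obj C \<Longrightarrow> Ident C a \<otimes>\<^sub>M Ident C b = Ident C (a \<otimes>\<^sub>O b)"
  by (rule TensorM_Ident)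

lemma TensorM_Scale_arr [simp]:
  assumes "f \<in> Arr C" "g \<in> Arr C"
  shows "Scale C r f \<otimes>\<^sub>M g = Scale C r (f \<otimes>\<^sub>M g)" "f \<otimes>\<^sub>M Scale C r g = Scale C r (f \<otimes>\<^sub>M g)"
  using TensorM_Scale_left[of f _ _ g] TensorM_Scale_right[of f _ _ g] assms by (auto simp: Hom_iff)

lemma TensorM_Zero_left [simp]:
  assumes "a \<in> Obj C" "b \<in> Obj C" "g \<in> Arr C"
  shows "Zero C a b \<otimes>\<^sub>M g = Zero C (a \<otimes>\<^sub>O Dom C g) (b \<otimes>\<^sub>O Cod C g)"
  using TensorM_Scale_arr(1)[of "Zero C a b" g 0] assms by simp

lemma TensorM_Zero_right [simp]:
  assumes "a \<in> Obj C" "b \<in> Obj C" "g \<in> Arr C"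
  shows "g \<otimes>\<^sub>M Zero C a b = Zero C (Dom C g \<otimes>\<^sub>O a) (Cod C g \<otimes>\<^sub>O b)"
  using TensorM_Scale_arr(2)[of g "Zero C a b" 0] assms by simp

lemma iso_arr_TensorM:
  assumes "iso_arr C a b f" "iso_arr C c d g"
  shows "iso_arr C (a \<otimes>\<^sub>O c) (b \<otimes>\<^sub>O d) (f \<otimes>\<^sub>M g)"
proof -
  obtain f' where f: "f \<in> Hom C a b" "f' \<in> Hom C b a" "f' \<bullet> f = Ident C a" "f \<bullet> f' = Ident C b"
    using assms(1) by (rule iso_arrE)
  obtain g' where g: "g \<in> Hom C c d" "g' \<in> Hom C d c" "g' \<bullet> g = Ident C c" "g \<bullet> g' = Ident C d"
    using assms(2) by (rule iso_arrE)
  have "a \<in> Obj C" "b \<in> Obj C" "c \<in> Obj C" "d \<in> Obj C"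
    using f g by (auto simp: Hom_iff)
  then show ?thesis
    using f g unfolding iso_arr_def
    by (auto intro!: bexI[of _ "f' \<otimes>\<^sub>M g'"] simp: Hom_iff TensorM_Comp_arr)
qed

lemma finsum_TensorM_right:
  assumes "finite I" "\<And>i. i \<in> I \<Longrightarrow> h i \<in> Hom C b c" "f \<in> Hom C a d" "b \<in> Obj C" "c \<in> Obj C"
  shows "f \<otimes>\<^sub>M finsum (hom_space C b c) h I =
    finsum (hom_space C (a \<otimes>\<^sub>O b) (d \<otimes>\<^sub>O c)) (\<lambda>i. f \<otimes>\<^sub>M h i) I"
proof (rule finsum_additive)
  show "abelian_monoid (hom_space C b c)" "abelian_monoid (hom_space C (a \<otimes>\<^sub>O b) (d \<otimes>\<^sub>O c))"
    using assms by (auto intro!: hom_space_abelian_monoid simp: Hom_iff)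
qed (use assms in \<open>auto simp: TensorM_Add_right Hom_iff\<close>)

section \<open>Invertible objects\<close>

text \<open>The natural isomorphism from \<open>(y \<otimes> l) \<otimes> l'\<close> to
  \<open>y\<close> induced by \<open>w : l \<otimes> l' \<rightarrow> 1\<close>: tensoring with
  \<open>l'\<close> undoes tensoring with \<open>l\<close>.\<close>

definition retract :: "'o \<Rightarrow> 'o \<Rightarrow> 'm \<Rightarrow> 'o \<Rightarrow> 'm" where
  "retract l l' w y = RUnitor C y \<bullet> (Ident C y \<otimes>\<^sub>M w) \<bullet> Assoc C y l l'"

lemma iso_arr_retract:
  assumes "iso_arr C (l \<otimes>\<^sub>O l') (Unit C) w" "l \<in> Obj C" "l' \<in> Obj C" "y \<in> Obj C"
  shows "iso_arr C (y \<otimes>\<^sub>O l \<otimes>\<^sub>O l') y (retract l l' w y)"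
  unfolding retract_def
  using assms by (intro iso_arr_Comp[of _ "y \<otimes>\<^sub>O Unit C"] iso_arr_Comp[of _ "y \<otimes>\<^sub>O (l \<otimes>\<^sub>O l')"]
    RUnitor_iso iso_arr_TensorM iso_arr_Ident Assoc_iso)

lemma retract_natural:
  assumes w: "iso_arr C (l \<otimes>\<^sub>O l') (Unit C) w" and l: "l \<in> Obj C" "l' \<in> Obj C"
    and f: "f \<in> Hom C y z"
  shows "retract l l' w z \<bullet> (f \<otimes>\<^sub>M Ident C l \<otimes>\<^sub>M Ident C l') = f \<bullet> retract l l' w y"
proof -
  note [simp] = l
  have w': "w \<in> Arr C" "Dom C w = l \<otimes>\<^sub>O l'" "Cod C w = Unit C"
    using iso_arr_Hom[OF w] by (auto simp: Hom_iff)
  have f': "f \<in> Arr C" "Dom C f = y" "Cod C f = z" and [simp]: "y \<in> Obj C" "z \<in> Obj C"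
    using f by (auto simp: Hom_iff)
  have "retract l l' w z \<bullet> (f \<otimes>\<^sub>M Ident C l \<otimes>\<^sub>M Ident C l') =
    RUnitor C z \<bullet> (f \<otimes>\<^sub>M w) \<bullet> Assoc C y l l'"
    using f' w' by (simp add: retract_def monoidal_simps)
  \<comment> \<open>Interchange law: \<open>f\<close> and \<open>w\<close> act on different factors,
    so \<open>w\<close> can be applied before \<open>f\<close>.\<close>
  also have "\<dots> = (RUnitor C z \<bullet> (f \<otimes>\<^sub>M Ident C (Unit C))) \<bullet> (Ident C y \<otimes>\<^sub>M w) \<bullet> Assoc C y l l'"
    using f' w' by (simp add: monoidal_simps)
  also have "\<dots> = f \<bullet> retract l l' w y"
    using f' w' by (simp add: RUnitor_natural[OF f] retract_def)
  finally show ?thesis .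
qed

text \<open>By naturality \<open>f \<otimes> l \<otimes> l'\<close> agrees with \<open>f\<close> up
  to the isomorphisms \<open>retract\<close>, so \<open>f\<close> can be recovered from
  \<open>f \<otimes> l\<close>.\<close>

lemma TensorM_faithful:
  assumes w: "iso_arr C (l \<otimes>\<^sub>O l') (Unit C) w" and l: "l \<in> Obj C" "l' \<in> Obj C"
    and f: "f \<in> Hom C y z" "g \<in> Hom C y z"
    and eq: "f \<otimes>\<^sub>M Ident C l = g \<otimes>\<^sub>M Ident C l"
  shows "f = g"
proof (rule iso_arr_cancel_right)
  show "iso_arr C (y \<otimes>\<^sub>O l \<otimes>\<^sub>O l') y (retract l l' w y)"
    using w l f by (intro iso_arr_retract) (auto simp: Hom_iff)
  show "f \<bullet> retract l l' w y = g \<bullet> retract l l' w y"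
    using retract_natural[OF w l f(1)] retract_natural[OF w l f(2)] eq by simp
qed fact+

text \<open>The identity and the zero endomorphism of \<open>y\<close> agree after tensoring with
  \<open>l\<close>, hence agree by faithfulness.\<close>

lemma zero_obj_TensorO:
  assumes w: "iso_arr C (l \<otimes>\<^sub>O l') (Unit C) w" and l: "l \<in> Obj C" "l' \<in> Obj C"
    and y: "y \<in> Obj C" "zero_obj C (y \<otimes>\<^sub>O l)"
  shows "zero_obj C y"
proof -
  have "Ident C y \<otimes>\<^sub>M Ident C l = Zero C y y \<otimes>\<^sub>M Ident C l"
    using y l by (simp add: zero_obj_def)
  then have "Ident C y = Zero C y y"
    using TensorM_faithful[OF w l Ident_Hom[OF y(1)] Zero_Hom[OF y(1,1)]] by blast
  then show ?thesis using y by (simp add: zero_obj_def)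
qed

text \<open>Naturality writes \<open>f \<bullet> retract l l' w y\<close> as a composite of
  isomorphisms; cancelling \<open>retract\<close> leaves \<open>f\<close>.\<close>

lemma iso_arr_TensorM_reflect:
  assumes w: "iso_arr C (l \<otimes>\<^sub>O l') (Unit C) w" and l: "l \<in> Obj C" "l' \<in> Obj C"
    and f: "f \<in> Hom C y z"
    and iso: "iso_arr C (y \<otimes>\<^sub>O l) (z \<otimes>\<^sub>O l) (f \<otimes>\<^sub>M Ident C l)"
  shows "iso_arr C y z f"
proof -
  have yz: "y \<in> Obj C" "z \<in> Obj C"
    using f by (auto simp: Hom_iff)
  have "iso_arr C (y \<otimes>\<^sub>O l \<otimes>\<^sub>O l') z (f \<bullet> retract l l' w y)"
    unfolding retract_natural[OF w l f, symmetric]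
    using w l yz
    by (intro iso_arr_Comp[of _ "z \<otimes>\<^sub>O l \<otimes>\<^sub>O l'"] iso_arr_TensorM iso iso_arr_Ident iso_arr_retract)
  then show ?thesis
    using iso_arr_Comp_right_iff[OF iso_arr_retract[OF w l yz(1)] f] by simp
qed

text \<open>Tensoring with an invertible object is an equivalence, hence reflects zero objects,
  isomorphisms and monomorphisms.\<close>

lemma simple_obj_TensorO_invertible:
  assumes x: "simple_obj C x" and l: "invertible_obj C l"
  shows "simple_obj C (x \<otimes>\<^sub>O l)"
proof -
  have lO: "l \<in> Obj C" and xO: "x \<in> Obj C" "\<not> zero_obj C x"
    using x l by (auto simp: simple_obj_def invertible_obj_def)
  obtain l' w w' where l': "l' \<in> Obj C"
    and w: "iso_arr C (l \<otimes>\<^sub>O l') (Unit C) w" and w': "iso_arr C (l' \<otimes>\<^sub>O l) (Unit C) w'"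
    using l unfolding invertible_obj_def iso_obj_def by blast
  note [simp] = lO l' xO(1)
  show ?thesis
    unfolding simple_obj_def
  proof (intro conjI allI impI)
    show "\<not> zero_obj C (x \<otimes>\<^sub>O l)"
      using zero_obj_TensorO[OF w lO l' xO(1)] xO(2) by blast
    fix y m assume m: "m \<in> Hom C y (x \<otimes>\<^sub>O l) \<and> monic C m"
    then have m_arr [simp]: "m \<in> Arr C" "Dom C m = y" "Cod C m = x \<otimes>\<^sub>O l" "y \<in> Obj C"
      by (auto simp: Hom_iff)
    \<comment> \<open>Simplicity is available for \<open>x\<close>, so the subobject
      \<open>m\<close> of \<open>x \<otimes> l\<close> is turned into a morphism into
      \<open>x\<close> by tensoring with \<open>l'\<close>.\<close>
    define n where "n = retract l l' w x \<bullet> (m \<otimes>\<^sub>M Ident C l')"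
    have r: "iso_arr C (x \<otimes>\<^sub>O l \<otimes>\<^sub>O l') x (retract l l' w x)"
      using w by (intro iso_arr_retract) auto
    then have r_arr [simp]: "retract l l' w x \<in> Arr C"
      "Dom C (retract l l' w x) = x \<otimes>\<^sub>O l \<otimes>\<^sub>O l'" "Cod C (retract l l' w x) = x"
      by (auto simp: Hom_iff dest: iso_arr_Hom)
    have n: "n \<in> Hom C (y \<otimes>\<^sub>O l') x"
      by (simp add: n_def Hom_iff)
    have "monic C n"
      unfolding monic_def
    proof (intro conjI allI ballI impI)
      fix c g h
      assume g: "g \<in> Hom C c (Dom C n)" and h: "h \<in> Hom C c (Dom C n)" and eq: "n \<bullet> g = n \<bullet> h"
      have g' [simp]: "g \<in> Arr C" "Dom C g = c" "Cod C g = y \<otimes>\<^sub>O l'"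
        "h \<in> Arr C" "Dom C h = c" "Cod C h = y \<otimes>\<^sub>O l'" "c \<in> Obj C"
        using g h n by (auto simp: Hom_iff)
      have gh: "g \<otimes>\<^sub>M Ident C l \<in> Hom C (c \<otimes>\<^sub>O l) (y \<otimes>\<^sub>O l' \<otimes>\<^sub>O l)"
        "h \<otimes>\<^sub>M Ident C l \<in> Hom C (c \<otimes>\<^sub>O l) (y \<otimes>\<^sub>O l' \<otimes>\<^sub>O l)"
        by (auto simp: Hom_iff)
      let ?r = "retract l' l w'"
      have r': "iso_arr C (y \<otimes>\<^sub>O l' \<otimes>\<^sub>O l) y (?r y)"
        using w' by (intro iso_arr_retract) auto
      then have r'_arr [simp]: "?r y \<in> Arr C" "Dom C (?r y) = y \<otimes>\<^sub>O l' \<otimes>\<^sub>O l" "Cod C (?r y) = y"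
        by (auto simp: Hom_iff dest: iso_arr_Hom)
      have r'': "iso_arr C (x \<otimes>\<^sub>O l \<otimes>\<^sub>O l' \<otimes>\<^sub>O l) (x \<otimes>\<^sub>O l) (?r (x \<otimes>\<^sub>O l))"
        using w' by (intro iso_arr_retract) auto
      then have r''_arr [simp]: "?r (x \<otimes>\<^sub>O l) \<in> Arr C"
        "Dom C (?r (x \<otimes>\<^sub>O l)) = x \<otimes>\<^sub>O l \<otimes>\<^sub>O l' \<otimes>\<^sub>O l" "Cod C (?r (x \<otimes>\<^sub>O l)) = x \<otimes>\<^sub>O l"
        by (auto simp: Hom_iff dest: iso_arr_Hom)
      have "(m \<otimes>\<^sub>M Ident C l') \<bullet> g = (m \<otimes>\<^sub>M Ident C l') \<bullet> h"
      proof (rule iso_arr_cancel_left[OF r])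
        show "retract l l' w x \<bullet> (m \<otimes>\<^sub>M Ident C l') \<bullet> g = retract l l' w x \<bullet> (m \<otimes>\<^sub>M Ident C l') \<bullet> h"
          using eq by (simp add: n_def)
      qed (simp_all add: Hom_iff)
      \<comment> \<open>Tensoring also with \<open>l\<close> lets \<open>retract\<close> for
        \<open>l' \<otimes> l\<close> strip both factors: by naturality \<open>m\<close> itself
        comes to the front, where its being monic applies.\<close>
      then have "((m \<otimes>\<^sub>M Ident C l') \<bullet> g) \<otimes>\<^sub>M Ident C l = ((m \<otimes>\<^sub>M Ident C l') \<bullet> h) \<otimes>\<^sub>M Ident C l"
        by simp
      then have "(m \<otimes>\<^sub>M Ident C l' \<otimes>\<^sub>M Ident C l) \<bullet> (g \<otimes>\<^sub>M Ident C l) =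
        (m \<otimes>\<^sub>M Ident C l' \<otimes>\<^sub>M Ident C l) \<bullet> (h \<otimes>\<^sub>M Ident C l)"
        by (simp add: TensorM_Comp_arr del: TensorM_Ident_arr)
      then have "(?r (x \<otimes>\<^sub>O l) \<bullet> (m \<otimes>\<^sub>M Ident C l' \<otimes>\<^sub>M Ident C l)) \<bullet> (g \<otimes>\<^sub>M Ident C l) =
        (?r (x \<otimes>\<^sub>O l) \<bullet> (m \<otimes>\<^sub>M Ident C l' \<otimes>\<^sub>M Ident C l)) \<bullet> (h \<otimes>\<^sub>M Ident C l)"
        by simp
      then have "m \<bullet> (?r y \<bullet> (g \<otimes>\<^sub>M Ident C l)) = m \<bullet> (?r y \<bullet> (h \<otimes>\<^sub>M Ident C l))"
        using m by (simp add: retract_natural[OF w' l' lO, of m y "x \<otimes>\<^sub>O l"])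
      then have "?r y \<bullet> (g \<otimes>\<^sub>M Ident C l) = ?r y \<bullet> (h \<otimes>\<^sub>M Ident C l)"
        using m by (auto simp: monic_def Hom_iff)
      then have "g \<otimes>\<^sub>M Ident C l = h \<otimes>\<^sub>M Ident C l"
        by (rule iso_arr_cancel_left[OF r' gh])
      then show "g = h"
        using TensorM_faithful[OF w lO l', of g c "y \<otimes>\<^sub>O l'" h] by (simp add: Hom_iff)
    qed (use n in \<open>auto simp: Hom_iff\<close>)
    then consider "zero_obj C (y \<otimes>\<^sub>O l')" | "iso_arr C (y \<otimes>\<^sub>O l') x n"
      using x n unfolding simple_obj_def by blast
    then show "zero_obj C y \<or> iso_arr C y (x \<otimes>\<^sub>O l) m"
    proof cases
      case 1
      then show ?thesis using zero_obj_TensorO[OF w' l' lO] by simp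
    next
      case 2
      then have "iso_arr C (y \<otimes>\<^sub>O l') (x \<otimes>\<^sub>O l \<otimes>\<^sub>O l') (m \<otimes>\<^sub>M Ident C l')"
        unfolding n_def using iso_arr_Comp_left_iff[OF r] by (auto simp: Hom_iff)
      then show ?thesis
        using m by (auto intro: iso_arr_TensorM_reflect[OF w' l' lO])
    qed
  qed simp
qed

end

section \<open>Endomorphisms of modules\<close>

lemma End_alg_sel [simp]:
  "carrier (End_alg C A M \<rho>) = {f \<in> Hom C M M. f \<bullet>\<^bsub>C\<^esub> \<rho> = \<rho> \<bullet>\<^bsub>C\<^esub> (f \<otimes>\<^sub>M\<^bsub>C\<^esub> Ident C A)}"
  "f \<otimes>\<^bsub>End_alg C A M \<rho>\<^esub> g = f \<bullet>\<^bsub>C\<^esub> g"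
  "\<one>\<^bsub>End_alg C A M \<rho>\<^esub> = Ident C M"
  "\<zero>\<^bsub>End_alg C A M \<rho>\<^esub> = Zero C M M"
  "f \<oplus>\<^bsub>End_alg C A M \<rho>\<^esub> g = Add C f g"
  "r \<odot>\<^bsub>End_alg C A M \<rho>\<^esub> f = Scale C r f"
  by (simp_all add: End_alg_def hom_space_def)

context linear_abelian_monoidal_category
begin

lemma k_algebra_End_alg:
  assumes A: "A \<in> Obj C" and \<rho>: "\<rho> \<in> Hom C (M \<otimes>\<^sub>O A) M"
  shows "k_algebra (End_alg C A M \<rho>)"
proof -
  let ?E = "End_alg C A M \<rho>"
  have \<rho>' [simp]: "\<rho> \<in> Arr C" "Dom C \<rho> = M \<otimes>\<^sub>O A" "Cod C \<rho> = M" and M: "M \<in> Obj C"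
    using \<rho> by (auto simp: Hom_iff)
  note [simp] = A M
  interpret H: module "ring_of_type_algebra :: 'k ring" "hom_space C M M"
    by (rule hom_space_module[OF M M])
  have smult: "Scale C r f \<in> carrier ?E" if "f \<in> carrier ?E" for r f
    using that by (auto simp: Hom_iff)
  have sub: "submodule (carrier ?E) (ring_of_type_algebra :: 'k ring) (hom_space C M M)"
  proof (rule H.submoduleI)
    show "\<ominus>\<^bsub>hom_space C M M\<^esub> f \<in> carrier ?E" if f: "f \<in> carrier ?E" for f
      using H.smult_l_minus[of 1 f] H.smult_one[of f] smult[OF f, of "\<ominus>\<^bsub>ring_of_type_algebra\<^esub> 1"] f
      by simp
    show "f \<oplus>\<^bsub>hom_space C M M\<^esub> g \<in> carrier ?E" if "f \<in> carrier ?E" "g \<in> carrier ?E" for f g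
    proof -
      have fg: "f \<in> Hom C M M" "g \<in> Hom C M M" "f \<bullet> \<rho> = \<rho> \<bullet> (f \<otimes>\<^sub>M Ident C A)"
        "g \<bullet> \<rho> = \<rho> \<bullet> (g \<otimes>\<^sub>M Ident C A)"
        using that by simp_all
      have "Add C f g \<bullet> \<rho> = Add C (f \<bullet> \<rho>) (g \<bullet> \<rho>)"
        by (rule Comp_Add_left[OF \<rho> fg(1,2)])
      also have "\<dots> = \<rho> \<bullet> Add C (f \<otimes>\<^sub>M Ident C A) (g \<otimes>\<^sub>M Ident C A)"
        using Comp_Add_right[OF _ _ \<rho>] TensorM_Hom[OF fg(1) Ident_Hom[OF A]]
          TensorM_Hom[OF fg(2) Ident_Hom[OF A]] fg by simp
      also have "\<dots> = \<rho> \<bullet> (Add C f g \<otimes>\<^sub>M Ident C A)"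
        using TensorM_Add_left[OF fg(1,2) Ident_Hom[OF A]] by simp
      finally show ?thesis using fg by (simp add: Add_Hom)
    qed
  qed (use smult in \<open>auto simp: Hom_iff\<close>)
  have "hom_space C M M \<lparr>carrier := carrier ?E\<rparr> = ?E"
    by (simp add: End_alg_def)
  with submodule.submodule_is_module[OF sub H.module_axioms]
  have mod: "module (ring_of_type_algebra :: 'k ring) ?E"
    by simp
  have "ring ?E"
  proof (rule ringI)
    show "abelian_group ?E" using mod by (simp add: module_def)
    show "Group.monoid ?E"
    proof (rule monoidI)
      show "f \<otimes>\<^bsub>?E\<^esub> g \<in> carrier ?E" if "f \<in> carrier ?E" "g \<in> carrier ?E" for f g
      proof -
        have f: "f \<in> Arr C" "Dom C f = M" "Cod C f = M" "f \<bullet> \<rho> = \<rho> \<bullet> (f \<otimes>\<^sub>M Ident C A)"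
          and g: "g \<in> Arr C" "Dom C g = M" "Cod C g = M" "g \<bullet> \<rho> = \<rho> \<bullet> (g \<otimes>\<^sub>M Ident C A)"
          using that by (simp_all add: Hom_iff)
        have "f \<bullet> g \<bullet> \<rho> = (f \<bullet> \<rho>) \<bullet> (g \<otimes>\<^sub>M Ident C A)"
          using f(1-3) g by simp
        also have "\<dots> = \<rho> \<bullet> ((f \<bullet> g) \<otimes>\<^sub>M Ident C A)"
          unfolding f(4) using f(1-3) g(1-3) by (simp add: TensorM_Comp_arr)
        finally show ?thesis using f(1-3) g(1-3) by (simp add: Hom_iff)
      qed
    qed (auto simp: Hom_iff)
  qed (auto simp: Comp_Add_left Comp_Add_right)
  then show ?thesis
    using mod by (auto simp: k_algebra_def Hom_iff)
qed

end

section \<open>Induced modules\<close>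

locale algebra_object = linear_abelian_monoidal_category C
  for C :: "('o, 'm, 'k::field, 'z) moncat_scheme" (structure) +
  fixes A :: 'o and \<mu> \<eta> :: 'm and x :: 'o
  assumes algebra_obj: "algebra_obj C A \<mu> \<eta>" and x_Obj [simp]: "x \<in> Obj C"
begin

lemma A_arr [simp]:
  "A \<in> Obj C" "\<mu> \<in> Arr C" "Dom C \<mu> = A \<otimes>\<^sub>O A" "Cod C \<mu> = A"
  "\<eta> \<in> Arr C" "Dom C \<eta> = Unit C" "Cod C \<eta> = A"
  using algebra_obj by (auto simp: algebra_obj_def Hom_iff)

abbreviation \<rho> :: 'm where "\<rho> \<equiv> Ind_action C A \<mu> x"

lemma rho_arr [simp]:
  "\<rho> \<in> Arr C" "Dom C \<rho> = x \<otimes>\<^sub>O A \<otimes>\<^sub>O A" "Cod C \<rho> = x \<otimes>\<^sub>O A"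
  by (simp_all add: Ind_action_def)

text \<open>The pentagon for \<open>x, A, A, A\<close> reduces the module axiom of
  \<open>x \<otimes> A\<close> to associativity of \<open>\<mu>\<close>.\<close>

lemma rho_assoc:
  "\<rho> \<bullet> (\<rho> \<otimes>\<^sub>M Ident C A) = \<rho> \<bullet> (Ident C (x \<otimes>\<^sub>O A) \<otimes>\<^sub>M \<mu>) \<bullet> Assoc C (x \<otimes>\<^sub>O A) A A"
proof -
  have assoc: "\<mu> \<bullet> (\<mu> \<otimes>\<^sub>M Ident C A) = \<mu> \<bullet> (Ident C A \<otimes>\<^sub>M \<mu>) \<bullet> Assoc C A A A"
    using algebra_obj by (simp add: algebra_obj_def)
  have "\<rho> \<bullet> (\<rho> \<otimes>\<^sub>M Ident C A) = \<rho> \<bullet> ((Ident C x \<otimes>\<^sub>M \<mu>) \<otimes>\<^sub>M Ident C A) \<bullet> (Assoc C x A A \<otimes>\<^sub>M Ident C A)"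
    by (simp add: Ind_action_def TensorM_Comp_arr)
  also have "\<dots> = (Ident C x \<otimes>\<^sub>M (\<mu> \<bullet> (\<mu> \<otimes>\<^sub>M Ident C A))) \<bullet> Assoc C x (A \<otimes>\<^sub>O A) A \<bullet>
      (Assoc C x A A \<otimes>\<^sub>M Ident C A)"
    by (simp add: Ind_action_def Assoc_natural_arr' TensorM_Comp_arr')
  \<comment> \<open>The last three arrows are grouped as one side of the pentagon, which the next
    step replaces by the other.\<close>
  also have "\<dots> = (Ident C x \<otimes>\<^sub>M \<mu>) \<bullet> (Ident C x \<otimes>\<^sub>M (Ident C A \<otimes>\<^sub>M \<mu>)) \<bullet>
      ((Ident C x \<otimes>\<^sub>M Assoc C A A A) \<bullet> Assoc C x (A \<otimes>\<^sub>O A) A \<bullet> (Assoc C x A A \<otimes>\<^sub>M Ident C A))"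
    unfolding assoc by (simp add: TensorM_Comp_arr')
  also have "\<dots> = (Ident C x \<otimes>\<^sub>M \<mu>) \<bullet> (Ident C x \<otimes>\<^sub>M (Ident C A \<otimes>\<^sub>M \<mu>)) \<bullet>
      Assoc C x A (A \<otimes>\<^sub>O A) \<bullet> Assoc C (x \<otimes>\<^sub>O A) A A"
    by (simp add: pentagon)
  also have "\<dots> = \<rho> \<bullet> (Ident C (x \<otimes>\<^sub>O A) \<otimes>\<^sub>M \<mu>) \<bullet> Assoc C (x \<otimes>\<^sub>O A) A A"
    by (simp add: Ind_action_def Assoc_natural_arr' flip: TensorM_Ident)
  finally show ?thesis .
qed

text \<open>For \<open>g : x \<rightarrow> x \<otimes> A\<close> this is the module map out of the
  free module \<open>x \<otimes> A\<close> corresponding to \<open>g\<close>.\<close>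

definition extend :: "'m \<Rightarrow> 'm" where
  "extend g = \<rho> \<bullet> (g \<otimes>\<^sub>M Ident C A)"

lemma extend_arr [simp]:
  assumes "g \<in> Arr C" "Cod C g = x \<otimes>\<^sub>O A"
  shows "extend g \<in> Arr C" "Dom C (extend g) = Dom C g \<otimes>\<^sub>O A" "Cod C (extend g) = x \<otimes>\<^sub>O A"
  using assms by (simp_all add: extend_def)

lemma k_algebra_End_Ind: "k_algebra (End_Ind C A \<mu> x)"
  unfolding End_Ind_def by (rule k_algebra_End_alg) (simp_all add: Hom_iff)

text \<open>\<open>g\<close> and \<open>\<mu>\<close> act on different factors, so \<open>g\<close>
  slides past the multiplication; what is left is \<open>rho_assoc\<close>.\<close>

lemma extend_End:
  assumes g: "g \<in> Hom C x (x \<otimes>\<^sub>O A)"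
  shows "extend g \<in> carrier (End_Ind C A \<mu> x)"
proof -
  have g' [simp]: "g \<in> Arr C" "Dom C g = x" "Cod C g = x \<otimes>\<^sub>O A"
    using g by (auto simp: Hom_iff)
  have "(g \<otimes>\<^sub>M Ident C A) \<bullet> \<rho> =
      (Ident C (x \<otimes>\<^sub>O A) \<otimes>\<^sub>M \<mu>) \<bullet> (g \<otimes>\<^sub>M (Ident C A \<otimes>\<^sub>M Ident C A)) \<bullet> Assoc C x A A"
    by (simp add: Ind_action_def monoidal_simps)
  also have "(g \<otimes>\<^sub>M (Ident C A \<otimes>\<^sub>M Ident C A)) \<bullet> Assoc C x A A =
      Assoc C (x \<otimes>\<^sub>O A) A A \<bullet> (g \<otimes>\<^sub>M Ident C A \<otimes>\<^sub>M Ident C A)"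
    by (simp add: Assoc_natural_arr)
  finally have "extend g \<bullet> \<rho> = (\<rho> \<bullet> (Ident C (x \<otimes>\<^sub>O A) \<otimes>\<^sub>M \<mu>) \<bullet> Assoc C (x \<otimes>\<^sub>O A) A A) \<bullet>
      (g \<otimes>\<^sub>M Ident C A \<otimes>\<^sub>M Ident C A)"
    by (simp add: extend_def)
  also have "\<dots> = \<rho> \<bullet> (extend g \<otimes>\<^sub>M Ident C A)"
    unfolding rho_assoc[symmetric] by (simp add: extend_def TensorM_Comp_arr)
  finally show ?thesis
    by (simp add: End_Ind_def Hom_iff)
qed

text \<open>One half of the free-forgetful adjunction. The other half would require the coherence of
  \<open>RUnitor C (x \<otimes>\<^sub>O A)\<close> with \<open>Assoc\<close>; it is avoided, since the components of the basis
  elements constructed below already show that they are linearly independent.\<close>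

lemma End_eq_extend:
  assumes f: "f \<in> carrier (End_Ind C A \<mu> x)"
  obtains e where "e \<in> Hom C x (x \<otimes>\<^sub>O A)" "f = extend (f \<bullet> e)"
proof -
  have f' [simp]: "f \<in> Arr C" "Dom C f = x \<otimes>\<^sub>O A" "Cod C f = x \<otimes>\<^sub>O A"
    and lin: "f \<bullet> \<rho> = \<rho> \<bullet> (f \<otimes>\<^sub>M Ident C A)"
    using f by (auto simp: End_Ind_def Hom_iff)
  obtain r where r: "r \<in> Hom C x (x \<otimes>\<^sub>O Unit C)" "RUnitor C x \<bullet> r = Ident C x"
    using RUnitor_iso[OF x_Obj] by (rule iso_arrE)
  then have r' [simp]: "r \<in> Arr C" "Dom C r = x" "Cod C r = x \<otimes>\<^sub>O Unit C"
    by (auto simp: Hom_iff)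
  \<comment> \<open>The unit of the free-forgetful adjunction at \<open>x\<close>; the unit law of
    \<open>A\<close> and the triangle axiom make \<open>extend e\<close> the identity.\<close>
  define e where "e = (Ident C x \<otimes>\<^sub>M \<eta>) \<bullet> r"
  have e [simp]: "e \<in> Arr C" "Dom C e = x" "Cod C e = x \<otimes>\<^sub>O A"
    by (simp_all add: e_def)
  have unit: "\<mu> \<bullet> (\<eta> \<otimes>\<^sub>M Ident C A) = LUnitor C A"
    using algebra_obj by (simp add: algebra_obj_def)
  have "extend e = \<rho> \<bullet> (Ident C x \<otimes>\<^sub>M \<eta> \<otimes>\<^sub>M Ident C A) \<bullet> (r \<otimes>\<^sub>M Ident C A)"
    by (simp add: extend_def e_def TensorM_Comp_arr)
  also have "\<dots> = ((Ident C x \<otimes>\<^sub>M LUnitor C A) \<bullet> Assoc C x (Unit C) A) \<bullet> (r \<otimes>\<^sub>M Ident C A)"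
    by (simp add: Ind_action_def Assoc_natural_arr' TensorM_Comp_arr' unit)
  also have "\<dots> = Ident C (x \<otimes>\<^sub>O A)"
    by (simp add: triangle TensorM_Comp_arr r(2))
  finally have ext_e: "extend e = Ident C (x \<otimes>\<^sub>O A)" .
  \<comment> \<open>\<open>f\<close> is linear over \<open>A\<close>, hence moves inside
    \<open>extend\<close>.\<close>
  have "f = f \<bullet> extend e"
    by (simp add: ext_e)
  also have "\<dots> = (f \<bullet> \<rho>) \<bullet> (e \<otimes>\<^sub>M Ident C A)"
    by (simp add: extend_def)
  also have "\<dots> = extend (f \<bullet> e)"
    unfolding lin by (simp add: extend_def TensorM_Comp_arr)
  finally show ?thesis
    using that[of e] by (simp add: Hom_iff)
qed

lemma extend_finsum:
  assumes "finite I" "\<And>i. i \<in> I \<Longrightarrow> g i \<in> Hom C x (x \<otimes>\<^sub>O A)"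
  shows "extend (finsum (hom_space C x (x \<otimes>\<^sub>O A)) g I) =
    finsum (End_Ind C A \<mu> x) (\<lambda>i. extend (g i)) I"
proof (rule finsum_additive)
  interpret E: ring "End_Ind C A \<mu> x"
    using k_algebra_End_Ind by (simp add: k_algebra_def)
  show "abelian_monoid (End_Ind C A \<mu> x)"
    by (rule E.abelian_monoid_axioms)
  show "extend \<in> carrier (hom_space C x (x \<otimes>\<^sub>O A)) \<rightarrow> carrier (End_Ind C A \<mu> x)"
    using extend_End by auto
  fix a b assume "a \<in> carrier (hom_space C x (x \<otimes>\<^sub>O A))" "b \<in> carrier (hom_space C x (x \<otimes>\<^sub>O A))"
  then have ab: "a \<in> Hom C x (x \<otimes>\<^sub>O A)" "b \<in> Hom C x (x \<otimes>\<^sub>O A)"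
    by simp_all
  have "\<rho> \<in> Hom C (x \<otimes>\<^sub>O A \<otimes>\<^sub>O A) (x \<otimes>\<^sub>O A)" "Ident C A \<in> Hom C A A"
    by (simp_all add: Hom_iff)
  with ab show "extend (a \<oplus>\<^bsub>hom_space C x (x \<otimes>\<^sub>O A)\<^esub> b) =
      extend a \<oplus>\<^bsub>End_Ind C A \<mu> x\<^esub> extend b"
    by (simp add: extend_def TensorM_Add_left Comp_Add_right[OF TensorM_Hom TensorM_Hom]
        End_Ind_def)
qed (use assms in \<open>auto simp: hom_space_abelian_monoid extend_def End_Ind_def\<close>)

end

section \<open>The stabilizer of a simple object\<close>

locale induced_simple = twisted_group_algebra C L lam \<psi> \<omega> A inc prj \<mu> \<eta>
  for C :: "('o, 'm, 'k::field, 'z) moncat_scheme" (structure)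
    and L :: "'g::{finite, ab_group_add} \<Rightarrow> 'o"
    and lam \<psi> \<omega> A inc prj \<mu> \<eta> +
  fixes x :: 'o
  assumes schur: "schur_lemma C" and simple: "simple_obj C x"
begin

sublocale algebra_object C A \<mu> \<eta> x
  using algebra simple by unfold_locales (auto simp: simple_obj_def)

abbreviation \<Sigma> :: "'g set" where "\<Sigma> \<equiv> stabilizer C L x"

abbreviation xL :: "'g \<Rightarrow> 'o" where "xL i \<equiv> x \<otimes>\<^sub>O L i"

lemma L_Obj [simp]: "L i \<in> Obj C"
  using L_invertible by (auto simp: invertible_obj_def)

lemma inc_prj [simp]:
  "inc i \<in> Arr C" "Dom C (inc i) = L i" "Cod C (inc i) = A"
  "prj i \<in> Arr C" "Dom C (prj i) = A" "Cod C (prj i) = L i"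
  "prj j \<bullet> inc i = (if i = j then Ident C (L i) else Zero C (L i) (L j))"
  using sum_L by (auto simp: direct_sum_def Hom_iff)

lemma simple_xL: "simple_obj C (xL i)"
  using simple L_invertible by (rule simple_obj_TensorO_invertible)

lemma xL_nonzero: "\<not> zero_obj C (xL i)"
  using simple_xL by (simp add: simple_obj_def)

lemma lam_iso: "iso_arr C (L i \<otimes>\<^sub>O L j) (L (i + j)) (lam i j)"
  using lam_basis L_add by (blast intro: hom_line_basis_iso iso_obj_sym)

lemma lam_arr [simp]:
  "lam i j \<in> Arr C" "Dom C (lam i j) = L i \<otimes>\<^sub>O L j" "Cod C (lam i j) = L (i + j)"
  using iso_arr_Hom[OF lam_iso] by (auto simp: Hom_iff)

text \<open>Both objects are isomorphic to \<open>x \<otimes> L i \<otimes> L j\<close>. With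
  \<open>y = x\<close> this gives closure of the stabilizer under sums and, for
  \<open>j = - i\<close>, under negatives.\<close>

lemma iso_obj_xL_add:
  assumes "iso_obj C (xL i) y"
  shows "iso_obj C (xL (i + j)) (y \<otimes>\<^sub>O L j)"
proof -
  obtain u where u: "iso_arr C (xL i) y u"
    using assms by (auto simp: iso_obj_def)
  have "iso_arr C (x \<otimes>\<^sub>O L i \<otimes>\<^sub>O L j) (xL (i + j))
      ((Ident C x \<otimes>\<^sub>M lam i j) \<bullet> Assoc C x (L i) (L j))"
    by (intro iso_arr_Comp[OF Assoc_iso] iso_arr_TensorM iso_arr_Ident lam_iso) auto
  moreover have "iso_arr C (x \<otimes>\<^sub>O L i \<otimes>\<^sub>O L j) (y \<otimes>\<^sub>O L j) (u \<otimes>\<^sub>M Ident C (L j))"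
    using u by (intro iso_arr_TensorM iso_arr_Ident) auto
  ultimately show ?thesis
    unfolding iso_obj_def by (meson iso_obj_def iso_obj_sym iso_obj_trans)
qed

lemma iso_obj_xL_0: "iso_obj C (xL 0) x"
proof -
  obtain u where "iso_arr C (L 0) (Unit C) u"
    using L_zero by (auto simp: iso_obj_def)
  then have "iso_arr C (xL 0) x (RUnitor C x \<bullet> (Ident C x \<otimes>\<^sub>M u))"
    by (intro iso_arr_Comp[OF _ RUnitor_iso] iso_arr_TensorM iso_arr_Ident) auto
  then show ?thesis by (auto simp: iso_obj_def)
qed

lemma add_subgroup_stabilizer: "add_subgroup \<Sigma>"
  unfolding add_subgroup_def
proof (intro conjI ballI)
  show "0 \<in> \<Sigma>"
    using iso_obj_xL_0 by (simp add: stabilizer_def)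
  fix s assume s: "s \<in> \<Sigma>"
  show "s + t \<in> \<Sigma>" if "t \<in> \<Sigma>" for t
    using s that iso_obj_xL_add[of s x t] iso_obj_trans by (auto simp: stabilizer_def)
  have "iso_obj C (xL (s + - s)) (x \<otimes>\<^sub>O L (- s))"
    using s by (intro iso_obj_xL_add) (simp add: stabilizer_def)
  then show "- s \<in> \<Sigma>"
    using iso_obj_xL_0 by (auto simp: stabilizer_def intro: iso_obj_trans iso_obj_sym)
qed

text \<open>An arbitrary choice. By Schur's lemma another one multiplies \<open>u s\<close> by a
  nonzero scalar, which rescales \<open>b s\<close> and changes the resulting cocycle by a
  coboundary.\<close>

definition u :: "'g \<Rightarrow> 'm" where
  "u s = (SOME f. iso_arr C x (xL s) f)"

lemma u_iso:
  assumes "s \<in> \<Sigma>"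
  shows "iso_arr C x (xL s) (u s)"
proof -
  have "\<exists>f. iso_arr C x (xL s) f"
    using iso_obj_sym[of "xL s" x] assms by (auto simp: stabilizer_def iso_obj_def)
  then show ?thesis
    unfolding u_def by (rule someI_ex)
qed

lemma u_arr [simp]:
  assumes "s \<in> \<Sigma>"
  shows "u s \<in> Arr C" "Dom C (u s) = x" "Cod C (u s) = xL s"
  using iso_arr_Hom[OF u_iso[OF assms]] by (auto simp: Hom_iff)

lemma hom_line_basis_iso_arr:
  assumes "simple_obj C y" "simple_obj C z" "iso_arr C y z f"
  shows "hom_line_basis C y z f"
proof (rule hom_line_basis_nonzero)
  show "hom_one_dim C y z"
    using schur assms unfolding schur_lemma_def iso_obj_def by meson
  show "f \<noteq> Zero C y z"
    using assms by (intro iso_arr_nonzero) (auto simp: simple_obj_def)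
qed (use assms in \<open>simp add: iso_arr_Hom\<close>)

definition hom_basis :: "'g \<Rightarrow> 'm" where
  "hom_basis s = (Ident C x \<otimes>\<^sub>M inc s) \<bullet> u s"

lemma hom_basis_arr [simp]:
  assumes "s \<in> \<Sigma>"
  shows "hom_basis s \<in> Arr C" "Dom C (hom_basis s) = x" "Cod C (hom_basis s) = x \<otimes>\<^sub>O A"
  using assms by (simp_all add: hom_basis_def)

text \<open>Splitting the identity of \<open>A\<close> along its summands writes \<open>g\<close> as
  the sum of its parts \<open>p i : x \<rightarrow> x \<otimes> L i\<close>, to each of which
  Schur's lemma applies.\<close>

lemma hom_basis_span:
  assumes g: "g \<in> Hom C x (x \<otimes>\<^sub>O A)"
  shows "\<exists>c. g = finsum (hom_space C x (x \<otimes>\<^sub>O A)) (\<lambda>s. Scale C (c s) (hom_basis s)) \<Sigma>"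
proof -
  let ?H = "hom_space C x (x \<otimes>\<^sub>O A)"
  interpret H: abelian_monoid ?H
    by (rule hom_space_abelian_monoid) auto
  have g' [simp]: "g \<in> Arr C" "Dom C g = x" "Cod C g = x \<otimes>\<^sub>O A"
    using g by (auto simp: Hom_iff)
  define p where "p i = (Ident C x \<otimes>\<^sub>M prj i) \<bullet> g" for i
  have p: "p i \<in> Hom C x (xL i)" for i
    by (simp add: p_def Hom_iff)
  then have p_arr [simp]: "p i \<in> Arr C" "Dom C (p i) = x" "Cod C (p i) = xL i" for i
    by (simp_all add: Hom_iff)
  have "\<exists>r. p s = Scale C r (u s)" if "s \<in> \<Sigma>" for s
    using hom_line_basis_iso_arr[OF simple simple_xL u_iso[OF that]] p
    by (auto simp: hom_line_basis_def)
  then obtain c where c: "\<And>s. s \<in> \<Sigma> \<Longrightarrow> p s = Scale C (c s) (u s)"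
    by metis
  have zero: "p i = Zero C x (xL i)" if "i \<notin> \<Sigma>" for i
  proof -
    have "\<not> iso_obj C x (xL i)"
      using that iso_obj_sym by (auto simp: stabilizer_def)
    then have "Hom C x (xL i) = {Zero C x (xL i)}"
      using schur simple simple_xL unfolding schur_lemma_def by metis
    then show ?thesis using p by auto
  qed
  have "Ident C A = finsum (hom_space C A A) (\<lambda>i. inc i \<bullet> prj i) UNIV"
    using sum_L by (simp add: direct_sum_def)
  then have "g = (Ident C x \<otimes>\<^sub>M finsum (hom_space C A A) (\<lambda>i. inc i \<bullet> prj i) UNIV) \<bullet> g"
    by (metis Comp_Ident(2) TensorM_Ident_arr A_arr(1) g'(1,3) x_Obj)
  also have "\<dots> = finsum (hom_space C (x \<otimes>\<^sub>O A) (x \<otimes>\<^sub>O A)) (\<lambda>i. Ident C x \<otimes>\<^sub>M (inc i \<bullet> prj i)) UNIV \<bullet> g"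
    by (subst finsum_TensorM_right[where a = x and d = x]) (auto simp: Hom_iff)
  also have "\<dots> = finsum ?H (\<lambda>i. (Ident C x \<otimes>\<^sub>M (inc i \<bullet> prj i)) \<bullet> g) UNIV"
    by (rule finsum_Comp) (auto simp: Hom_iff)
  also have "\<dots> = finsum ?H (\<lambda>i. (Ident C x \<otimes>\<^sub>M inc i) \<bullet> p i) UNIV"
    by (rule H.finsum_cong') (auto simp: p_def TensorM_Comp_arr' Hom_iff)
  \<comment> \<open>Indices outside the stabilizer drop out, since \<open>p i\<close> is zero
    there.\<close>
  also have "\<dots> = finsum ?H (\<lambda>s. Scale C (c s) (hom_basis s)) \<Sigma>"
    by (rule H.add.finprod_mono_neutral_cong_right) (auto simp: zero c hom_basis_def Hom_iff)
  finally show ?thesis by blast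
qed

section \<open>Basis endomorphisms and their components\<close>

definition b :: "'g \<Rightarrow> 'm" where
  "b s = extend (hom_basis s)"

text \<open>The block of \<open>b s\<close> from \<open>x \<otimes> L j\<close> to
  \<open>x \<otimes> L (s + j)\<close>; the scalar \<open>\<omega> s j\<close> and
  \<open>lam s j\<close> together form the component of \<open>\<mu>\<close> on
  \<open>L s \<otimes> L j\<close>.\<close>

definition v :: "'g \<Rightarrow> 'g \<Rightarrow> 'm" where
  "v s j = Scale C (\<omega> s j)
    ((Ident C x \<otimes>\<^sub>M lam s j) \<bullet> Assoc C x (L s) (L j) \<bullet> (u s \<otimes>\<^sub>M Ident C (L j)))"

lemma v_iso:
  assumes "s \<in> \<Sigma>"
  shows "iso_arr C (xL j) (xL (s + j)) (v s j)"
  unfolding v_def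
  by (intro iso_arr_Scale iso_arr_Comp[of _ "xL s \<otimes>\<^sub>O L j"] iso_arr_Comp[of _ "x \<otimes>\<^sub>O (L s \<otimes>\<^sub>O L j)"]
      iso_arr_TensorM iso_arr_Ident u_iso lam_iso Assoc_iso) (auto simp: assms omega_nonzero)

lemma v_arr [simp]:
  assumes "s \<in> \<Sigma>"
  shows "v s j \<in> Arr C" "Dom C (v s j) = xL j" "Cod C (v s j) = xL (s + j)"
  using iso_arr_Hom[OF v_iso[OF assms]] by (auto simp: Hom_iff)

lemma b_arr [simp]:
  assumes "s \<in> \<Sigma>"
  shows "b s \<in> Arr C" "Dom C (b s) = x \<otimes>\<^sub>O A" "Cod C (b s) = x \<otimes>\<^sub>O A"
  using assms by (simp_all add: b_def)

text \<open>Naturality of \<open>Assoc\<close> brings both inclusions next to \<open>\<mu>\<close>,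
  where \<open>mu_component\<close> applies. As \<open>j\<close> is arbitrary, \<open>b s\<close> is
  homogeneous of grade \<open>s\<close>.\<close>

lemma b_component:
  assumes "s \<in> \<Sigma>"
  shows "b s \<bullet> (Ident C x \<otimes>\<^sub>M inc j) = (Ident C x \<otimes>\<^sub>M inc (s + j)) \<bullet> v s j"
proof -
  note [simp] = assms
  have "b s \<bullet> (Ident C x \<otimes>\<^sub>M inc j) =
      \<rho> \<bullet> ((Ident C x \<otimes>\<^sub>M inc s) \<otimes>\<^sub>M inc j) \<bullet> (u s \<otimes>\<^sub>M Ident C (L j))"
    by (simp add: b_def extend_def hom_basis_def TensorM_Comp_arr)
  also have "\<dots> = (Ident C x \<otimes>\<^sub>M (\<mu> \<bullet> (inc s \<otimes>\<^sub>M inc j))) \<bullet> Assoc C x (L s) (L j) \<bullet>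
      (u s \<otimes>\<^sub>M Ident C (L j))"
    by (simp add: Ind_action_def Assoc_natural_arr' TensorM_Comp_arr')
  also have "\<dots> = (Ident C x \<otimes>\<^sub>M inc (s + j)) \<bullet> v s j"
    by (simp add: mu_component v_def TensorM_Comp_arr')
  finally show ?thesis .
qed

abbreviation E :: "('k, 'm) module" where "E \<equiv> End_Ind C A \<mu> x"

lemma End_arr:
  assumes "f \<in> carrier E"
  shows "f \<in> Arr C" "Dom C f = x \<otimes>\<^sub>O A" "Cod C f = x \<otimes>\<^sub>O A"
  using assms by (auto simp: End_Ind_def Hom_iff)

lemma b_End: "s \<in> \<Sigma> \<Longrightarrow> b s \<in> carrier E"
  unfolding b_def by (rule extend_End) (simp add: Hom_iff)

text \<open>Since \<open>f\<close> is \<open>extend (f \<bullet> e)\<close> and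
  \<open>extend\<close> is linear, it suffices to expand \<open>f \<bullet> e\<close> in the family
  \<open>hom_basis\<close>.\<close>

lemma End_span:
  assumes "f \<in> carrier E"
  shows "\<exists>c. f = finsum E (\<lambda>s. c s \<odot>\<^bsub>E\<^esub> b s) \<Sigma>"
proof -
  interpret E: ring E
    using k_algebra_End_Ind by (simp add: k_algebra_def)
  obtain e where e: "e \<in> Hom C x (x \<otimes>\<^sub>O A)" "f = extend (f \<bullet> e)"
    using assms by (rule End_eq_extend)
  have "f \<bullet> e \<in> Hom C x (x \<otimes>\<^sub>O A)"
    using e(1) End_arr[OF assms] by (simp add: Hom_iff)
  then obtain c where
    c: "f \<bullet> e = finsum (hom_space C x (x \<otimes>\<^sub>O A)) (\<lambda>s. Scale C (c s) (hom_basis s)) \<Sigma>"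
    using hom_basis_span by blast
  have "f = finsum E (\<lambda>s. extend (Scale C (c s) (hom_basis s))) \<Sigma>"
    by (subst e(2), subst c, rule extend_finsum) (auto simp: Hom_iff)
  also have "\<dots> = finsum E (\<lambda>s. c s \<odot>\<^bsub>E\<^esub> b s) \<Sigma>"
  proof (rule E.finsum_cong')
    show "extend (Scale C (c s) (hom_basis s)) = c s \<odot>\<^bsub>E\<^esub> b s" if "s \<in> \<Sigma>" for s
      using that by (simp add: extend_def b_def End_Ind_def)
    then show "(\<lambda>s. c s \<odot>\<^bsub>E\<^esub> b s) \<in> \<Sigma> \<rightarrow> carrier E"
      by (auto intro!: extend_End simp: Hom_iff simp flip: \<open>\<And>s. _ \<Longrightarrow> _ = c s \<odot>\<^bsub>E\<^esub> b s\<close>)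
  qed simp
  finally show ?thesis by blast
qed

text \<open>A matrix entry in the column of grade 0. This column alone separates the
  \<open>b s\<close>: the only nonzero entry of \<open>b s\<close> there is the isomorphism
  \<open>v s 0\<close> in row \<open>s\<close>.\<close>

definition component :: "'g \<Rightarrow> 'm \<Rightarrow> 'm" where
  "component s f = (Ident C x \<otimes>\<^sub>M prj s) \<bullet> f \<bullet> (Ident C x \<otimes>\<^sub>M inc 0)"

text \<open>Measured against \<open>v s 0\<close>, the entry of \<open>b s\<close> itself, so that
  these functionals are dual to the basis.\<close>

definition coord :: "'g \<Rightarrow> 'm \<Rightarrow> 'k" where
  "coord s f = line_coeff (v s 0) (component s f)"

lemma v_basis: "s \<in> \<Sigma> \<Longrightarrow> hom_line_basis C (xL 0) (xL s) (v s 0)"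
  using hom_line_basis_iso_arr[OF simple_xL simple_xL v_iso[of s 0]] by simp

lemma component_Hom:
  "f \<in> carrier E \<Longrightarrow> component s f \<in> Hom C (xL 0) (xL s)"
  by (simp add: component_def Hom_iff End_arr)

lemma component_graded:
  assumes "f \<bullet> (Ident C x \<otimes>\<^sub>M inc 0) = (Ident C x \<otimes>\<^sub>M inc t) \<bullet> g" "g \<in> Hom C (xL 0) (xL t)"
  shows "component s f = (if s = t then g else Zero C (xL 0) (xL s))"
proof -
  have [simp]: "g \<in> Arr C" "Dom C g = xL 0" "Cod C g = xL t"
    using assms(2) by (auto simp: Hom_iff)
  show ?thesis
    unfolding component_def assms(1) by (simp add: TensorM_Comp_arr')
qed

sublocale basis: coordinate_basis E \<Sigma> b coord
proof
  show "k_algebra E" by (rule k_algebra_End_Ind)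
  show "finite \<Sigma>" by simp
  show "b s \<in> carrier E" if "s \<in> \<Sigma>" for s using that by (rule b_End)
  show "\<exists>c. f = finsum E (\<lambda>s. c s \<odot>\<^bsub>E\<^esub> b s) \<Sigma>" if "f \<in> carrier E" for f
    using that by (rule End_span)
  fix s assume s: "s \<in> \<Sigma>"
  show "coord s (f \<oplus>\<^bsub>E\<^esub> f') = coord s f + coord s f'" if f: "f \<in> carrier E" "f' \<in> carrier E" for f f'
  proof -
    have H: "Ident C x \<otimes>\<^sub>M prj s \<in> Hom C (x \<otimes>\<^sub>O A) (xL s)"
      "Ident C x \<otimes>\<^sub>M inc 0 \<in> Hom C (xL 0) (x \<otimes>\<^sub>O A)"
      "f \<in> Hom C (x \<otimes>\<^sub>O A) (x \<otimes>\<^sub>O A)" "f' \<in> Hom C (x \<otimes>\<^sub>O A) (x \<otimes>\<^sub>O A)"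
      using f by (auto simp: Hom_iff End_arr)
    have "component s (Add C f f') = Add C (component s f) (component s f')"
      unfolding component_def Comp_Add_left[OF H(2-4)]
      by (rule Comp_Add_right[OF Comp_Hom[OF H(2,3)] Comp_Hom[OF H(2,4)] H(1)])
    then show ?thesis
      using line_coeff_Add[OF v_basis[OF s] component_Hom[OF f(1)] component_Hom[OF f(2)]]
      by (simp add: coord_def End_Ind_def)
  qed
  show "coord s (r \<odot>\<^bsub>E\<^esub> f) = r * coord s f" if f: "f \<in> carrier E" for r f
  proof -
    have "component s (Scale C r f) = Scale C r (component s f)"
      using End_arr[OF f] by (simp add: component_def)
    then show ?thesis
      using line_coeff_Scale[OF v_basis[OF s] component_Hom[OF f]]
      by (simp add: coord_def End_Ind_def)
  qed
  show "coord s (b t) = (if s = t then 1 else 0)" if t: "t \<in> \<Sigma>" for t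
  proof -
    have "component s (b t) = (if s = t then v t 0 else Zero C (xL 0) (xL s))"
      using b_component[OF t, of 0] iso_arr_Hom[OF v_iso[OF t, of 0]] by (intro component_graded) auto
    \<comment> \<open>Both cases are written as multiples of \<open>v s 0\<close>, the form to which
      \<open>line_coeff_eq\<close> applies.\<close>
    also have "\<dots> = Scale C (if s = t then 1 else 0) (v s 0)"
      using s t by simp
    finally show ?thesis
      using line_coeff_eq[OF v_basis[OF s]] by (simp add: coord_def)
  qed
qed

text \<open>An \<open>f\<close> of grade \<open>s\<close> sends \<open>x \<otimes> L 0\<close> into
  \<open>x \<otimes> L s\<close>, so its coordinates away from \<open>s\<close> vanish; column 0 is
  enough for this. The converse is \<open>b_component\<close> for every \<open>j\<close>.\<close>

lemma grade_eq:
  assumes s: "s \<in> \<Sigma>"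
  shows "End_Ind_grade C L A inc \<mu> x s = {r \<odot>\<^bsub>E\<^esub> b s | r. True}"
proof (intro subset_antisym subsetI)
  fix f assume f: "f \<in> End_Ind_grade C L A inc \<mu> x s"
  then have fE: "f \<in> carrier E"
    by (simp add: End_Ind_grade_def)
  obtain g where g: "g \<in> Hom C (xL 0) (xL s)"
    "f \<bullet> (Ident C x \<otimes>\<^sub>M inc 0) = (Ident C x \<otimes>\<^sub>M inc s) \<bullet> g"
    using f by (auto simp: End_Ind_grade_def dest!: spec[of _ 0])
  have "f = coord s f \<odot>\<^bsub>E\<^esub> b s"
  proof (rule basis.eq_by_coord)
    show "coord s f \<odot>\<^bsub>E\<^esub> b s \<in> carrier E"
      using basis.smult_simps(1) b_End[OF s] .
    fix t assume t: "t \<in> \<Sigma>"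
    have "coord t f = 0" if "t \<noteq> s"
    proof -
      have "component t f = Scale C 0 (v t 0)"
        using component_graded[OF g(2,1), of t] that t by simp
      then show ?thesis
        using line_coeff_eq[OF v_basis[OF t]] by (simp add: coord_def)
    qed
    then show "coord t f = coord t (coord s f \<odot>\<^bsub>E\<^esub> b s)"
      using s t by (auto simp: basis.coord_smult basis.coord_b b_End)
  qed fact
  then show "f \<in> {r \<odot>\<^bsub>E\<^esub> b s | r. True}" by blast
next
  fix f assume "f \<in> {r \<odot>\<^bsub>E\<^esub> b s | r. True}"
  then obtain r where f: "f = r \<odot>\<^bsub>E\<^esub> b s" by blast
  have "f \<bullet> (Ident C x \<otimes>\<^sub>M inc j) = (Ident C x \<otimes>\<^sub>M inc (s + j)) \<bullet> Scale C r (v s j)" for j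
    using s by (simp add: f End_Ind_def b_component)
  moreover have "Scale C r (v s j) \<in> Hom C (xL j) (xL (s + j))" for j
    using s by (simp add: Hom_iff)
  moreover have "f \<in> carrier E"
    unfolding f using basis.smult_simps(1) b_End[OF s] .
  ultimately show "f \<in> End_Ind_grade C L A inc \<mu> x s"
    unfolding End_Ind_grade_def by blast
qed

text \<open>The product is homogeneous of grade \<open>s + t\<close>, and by \<open>grade_eq\<close>
  that grade is the line through \<open>b (s + t)\<close>; this yields the scalar without computing
  it.\<close>

lemma b_mult:
  assumes s: "s \<in> \<Sigma>" and t: "t \<in> \<Sigma>"
  shows "\<exists>r. r \<noteq> 0 \<and> b s \<bullet> b t = r \<odot>\<^bsub>E\<^esub> b (s + t)"
proof -
  note [simp] = s t
  have st: "s + t \<in> \<Sigma>"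
    using add_subgroup_stabilizer s t by (simp add: add_subgroup_def)
  have comp: "(b s \<bullet> b t) \<bullet> (Ident C x \<otimes>\<^sub>M inc j) =
      (Ident C x \<otimes>\<^sub>M inc (s + t + j)) \<bullet> (v s (t + j) \<bullet> v t j)" for j
  proof -
    have "(b s \<bullet> b t) \<bullet> (Ident C x \<otimes>\<^sub>M inc j) = (b s \<bullet> (Ident C x \<otimes>\<^sub>M inc (t + j))) \<bullet> v t j"
      by (simp add: b_component[OF t])
    then show ?thesis
      unfolding b_component[OF s] by (simp add: add.assoc)
  qed
  have v: "iso_arr C (xL j) (xL (s + t + j)) (v s (t + j) \<bullet> v t j)" for j
    using iso_arr_Comp[OF v_iso[OF t] v_iso[OF s]] by (simp add: add.assoc)
  have "b s \<bullet> b t \<in> carrier E"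
    using basis.Alg.m_closed[OF b_End[OF s] b_End[OF t]] by (simp add: End_Ind_def)
  then have "b s \<bullet> b t \<in> End_Ind_grade C L A inc \<mu> x (s + t)"
    using comp v iso_arr_Hom unfolding End_Ind_grade_def by blast
  then obtain r where r: "b s \<bullet> b t = r \<odot>\<^bsub>E\<^esub> b (s + t)"
    unfolding grade_eq[OF st] by blast
  \<comment> \<open>In column 0 the product has the block \<open>v s t \<bullet> v t 0\<close>, a
    composite of isomorphisms out of a nonzero object.\<close>
  have "r \<noteq> 0"
  proof
    assume "r = 0"
    then have "component (s + t) (b s \<bullet> b t) = Zero C (xL 0) (xL (s + t))"
      using r st by (simp add: component_def End_Ind_def)
    moreover have "component (s + t) (b s \<bullet> b t) = v s t \<bullet> v t 0"
      using component_graded[of "b s \<bullet> b t" "s + t" "v s t \<bullet> v t 0"] comp[of 0] by (simp add: Hom_iff)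
    ultimately show False
      using iso_arr_nonzero[OF v[of 0] xL_nonzero] by simp
  qed
  then show ?thesis using r by blast
qed

text \<open>The values of \<open>\<theta>\<close> are chosen pair by pair from
  \<open>b_mult\<close>; they satisfy the cocycle identity because composition in \<open>E\<close>
  is associative.\<close>

lemma twisted_group_ring_iso:
  obtains \<theta> \<Phi> where "two_cocycle \<Sigma> \<theta>"
    "graded_k_algebra_iso \<Sigma> E (End_Ind_grade C L A inc \<mu> x)
      (twisted_group_ring \<Sigma> \<theta>) twisted_grade \<Phi>"
proof -
  obtain \<theta> where \<theta>: "\<And>s t. s \<in> \<Sigma> \<Longrightarrow> t \<in> \<Sigma> \<Longrightarrow> \<theta> s t \<noteq> 0 \<and> b s \<bullet> b t = \<theta> s t \<odot>\<^bsub>E\<^esub> b (s + t)"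
    using b_mult by metis
  interpret homogeneous_basis E \<Sigma> b coord \<theta> "End_Ind_grade C L A inc \<mu> x"
    using \<theta> add_subgroup_stabilizer grade_eq by unfold_locales (auto simp: End_Ind_def)
  show ?thesis
    using that two_cocycle_theta graded_iso by blast
qed

end

theorem proposition4p5:
  fixes C :: "('o, 'm, 'k::alg_closed_field) moncat"
    and L :: "'g::{finite, ab_group_add} \<Rightarrow> 'o"
    and lam :: "'g \<Rightarrow> 'g \<Rightarrow> 'm"
    and \<psi> :: "'g \<Rightarrow> 'g \<Rightarrow> 'g \<Rightarrow> 'k"
    and \<omega> :: "'g \<Rightarrow> 'g \<Rightarrow> 'k"
    and A x :: "'o"
    and inc prj :: "'g \<Rightarrow> 'm"
    and \<mu> \<eta> :: "'m"
  assumes "CHAR('k) = 0 \<or> coprime CHAR('k) (card (UNIV :: 'g set))"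
    and "linear_abelian_monoidal_category C"
    and "simple_obj C (Unit C)"
    and "hom_one_dim C (Unit C) (Unit C)"
    and "schur_lemma C"
    and "twisted_group_algebra C L lam \<psi> \<omega> A inc prj \<mu> \<eta>"
    and "simple_obj C x"
  shows "\<exists>\<theta> :: 'g \<Rightarrow> 'g \<Rightarrow> 'k. two_cocycle (stabilizer C L x) \<theta> \<and>
    (\<exists>\<Phi>. graded_k_algebra_iso (stabilizer C L x)
      (End_Ind C A \<mu> x) (End_Ind_grade C L A inc \<mu> x)
      (twisted_group_ring (stabilizer C L x) \<theta>) twisted_grade \<Phi>)"
proof -
  interpret induced_simple C L lam \<psi> \<omega> A inc prj \<mu> \<eta> x
    by (intro induced_simple.intro induced_simple_axioms.intro assms)
  show ?thesis
    by (rule twisted_group_ring_iso) blast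
qed

end
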